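(* Fix a type $\sigma$ of $\mathsf{T}$. Let \[ \mathsf{J}\mathbb{N}=(\mathbb{N}^\mathbb{N}\to\mathbb{N})\times(\mathbb{N}^*\to\mathbf{2})\times\big((\mathbb{N}^*\to\sigma)\to(\mathbb{N}^*\to\sigma^\mathbb{N}\to\sigma)\to\mathbb{N}^*\to\sigma\big), \] writing $\mathrm{V}_w,\mathrm{S}_w,\mathrm{B}_w$ for the three components of $w:\mathsf{J}\mathbb{N}$. Define \[ \eta(n):=\langle\lambda\alpha.n,\ \lambda s.1,\ \lambda GH.G\rangle, \] \[ \kappa(g,w):=\big\langle\lambda\alpha.\mathrm{V}_{g(\mathrm{V}_w\alpha)}\alpha,\ \lambda s.\min(\mathrm{S}_w(s),\mathrm{S}_{g(\mathrm{V}_w\hat s)}(s)),\ \lambda GH.\mathrm{B}_w(\lambda s.\mathrm{B}_{g(\mathrm{V}_w\hat s)}(G,H,s),H)\big\rangle, \] and $\Omega:\mathsf{J}\mathbb{N}\to\mathsf{J}\mathbb{N}$ by $\Omega:=\kappa(\lambda n.\langle\lambda\alpha.\alpha n,\ \lambda s.\mathrm{Le}(n,|s|),\ \Psi n\rangle)$, where $\mathrm{Le}(n,k)=1$ iff $n<k$ (and $0$ otherwise), and $\Psi$ is a closed $\mathsf{T}$-term such that for all $n,G,H,s$: if $n<|s|$ then $\Psi n(G,H,s)=G(s)$, and if $n\ge|s|$ then $\Psi n(G,H,s)=H(s,\lambda m.\Psi n(G,H,s*m))$. Then for every closed term $Y:\mathbb{N}^\mathbb{N}\to\mathbb{N}$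 of $\mathsf{T}$: (1) $\mathrm{S}_{Y^\mathsf{J}\Omega}$ is a monotone predicate securing $Y$; and (2) $\mathrm{B}_{Y^\mathsf{J}\Omega}$ is a functional of general bar recursion for $\mathrm{S}_{Y^\mathsf{J}\Omega}$, i.e. $\mathcal{GBR}_{\mathrm{S}_{Y^\mathsf{J}\Omega}}(\mathrm{B}_{Y^\mathsf{J}\Omega})$ holds.
   Context: System $\mathsf{T}$ extended with products: types $\mathbb{N}$, $\sigma\to\tau$, $\sigma\times\tau$; terms: variables, $\lambda$, application, $0$, $\mathsf{suc}$, $\mathsf{rec}_\sigma:\sigma\to(\mathbb{N}\to\sigma\to\sigma)\to\mathbb{N}\to\sigma$ (with $\mathsf{rec}(a,f,0)=a$, $\mathsf{rec}(a,f,n+1)=f(n,\mathsf{rec}(a,f,n))$), and pairing $\langle\cdot,\cdot\rangle$ with projections. Terms are interpreted as functionals of finite type. $\mathbb{N}^\mathbb{N}=\mathbb{N}\to\mathbb{N}$, $\sigma^\mathbb{N}=\mathbb{N}\to\sigma$; $\mathbb{N}^*$ is the type of finite sequences of naturals and $\mathbf{2}=\{0,1\}$ (both encodable in $\mathsf{T}$); $\min$ returns the smaller argument. For $S:\mathbb{N}^*\to\mathbf{2}$, $S(s)$ means $S(s)=1$. For $s:\mathbb{N}^*$: $|s|$ is its length, $\hat s:\mathbb{N}^\mathbb{N}$ is $s$ extended by infinitely many $0$'s, $s*n$ appends $n$, and $s*\alpha$ is the concatenation with $\alpha:\mathbb{N}^\mathbb{N}$. $S$ is monotone if $S(s)$ implies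 $S(s*n)$ for all $s,n$. $S$ secures $Y:\mathbb{N}^\mathbb{N}\to\mathbb{N}$ if $\forall s\,(S(s)\to\forall\alpha\,Y(s*\alpha)=Y(\hat s))$. For $\xi:(\mathbb{N}^*\to\sigma)\to(\mathbb{N}^*\to\sigma^\mathbb{N}\to\sigma)\to\mathbb{N}^*\to\sigma$, $\mathcal{GBR}_S(\xi)$ means: for all $G,H,s$, if $S(s)$ then $\xi(G,H,s)=G(s)$, and if $\neg S(s)$ then $\xi(G,H,s)=H(s,\lambda n.\xi(G,H,s*n))$. The $\mathsf{J}$-translation for a nucleus $(\mathsf{J}\mathbb{N},\eta,\kappa)$ (type $\mathsf{J}\mathbb{N}$, terms $\eta:\mathbb{N}\to\mathsf{J}\mathbb{N}$, $\kappa:(\mathbb{N}\to\mathsf{J}\mathbb{N})\to\mathsf{J}\mathbb{N}\to\mathsf{J}\mathbb{N}$): $\mathbb{N}^\mathsf{J}:=\mathsf{J}\mathbb{N}$, $(\sigma\to\tau)^\mathsf{J}:=\sigma^\mathsf{J}\to\tau^\mathsf{J}$, $(\sigma\times\tau)^\mathsf{J}:=\sigma^\mathsf{J}\times\tau^\mathsf{J}$; variables $x:\sigma$ go to fresh $x^\mathsf{J}:\sigma^\mathsf{J}$, $(\lambda x.t)^\mathsf{J}:=\lambda x^\mathsf{J}.t^\mathsf{J}$, $(tu)^\mathsf{J}:=t^\mathsf{J}u^\mathsf{J}$, $0^\mathsf{J}:=\eta\,0$, $\mathsf{suc}^\mathsf{J}:=\kappa(\eta\circ\mathsf{suc})$,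 pairing and projections translate to themselves at translated types, $(\mathsf{rec}_\tau)^\mathsf{J}:=\lambda x f.\,\mathrm{ke}_\tau(\mathsf{rec}_{\tau^\mathsf{J}}(x,f\circ\eta))$ with $\mathrm{ke}_\mathbb{N}:=\kappa$, $\mathrm{ke}_{\rho\to\tau}:=\lambda g\,a\,x.\,\mathrm{ke}_\tau(\lambda n.g(n,x),a)$, $\mathrm{ke}_{\rho\times\tau}:=\lambda g\,a.\langle\mathrm{ke}_\rho(\mathsf{pr}_1\circ g,a),\mathrm{ke}_\tau(\mathsf{pr}_2\circ g,a)\rangle$. So $Y^\mathsf{J}:(\mathsf{J}\mathbb{N}\to\mathsf{J}\mathbb{N})\to\mathsf{J}\mathbb{N}$. *)

theory Defs
  imports "HOL-Library.Nat_Bijection"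
begin

section \<open>Syntax of System T with products\<close>

datatype ty = N | Fun ty ty (infixr "\<rightarrow>" 60) | Prd ty ty (infixr "\<otimes>" 65)

text \<open>Church-style terms with de Bruijn indices: \<open>Lam \<sigma> t\<close> binds index 0 of \<open>t\<close>, of type \<open>\<sigma>\<close>.\<close>

datatype trm =
    Var nat
  | Lam ty trm
  | App trm trm (infixl "\<bullet>" 100)
  | Zero
  | Succ
  | Rec ty
  | Pr trm trm
  | Fst trm
  | Snd trm

inductive typing :: "ty list \<Rightarrow> trm \<Rightarrow> ty \<Rightarrow> bool" ("_ \<turnstile> _ \<Colon> _" [50, 50, 50] 50) where
  "i < length \<Gamma> \<Longrightarrow> \<Gamma> \<turnstile> Var i \<Colon> \<Gamma> ! i"
| "\<sigma> # \<Gamma> \<turnstile> t \<Colon> \<tau> \<Longrightarrow> \<Gamma> \<turnstile> Lam \<sigma> t \<Colon> \<sigma> \<rightarrow> \<tau>"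
| "\<Gamma> \<turnstile> t \<Colon> \<sigma> \<rightarrow> \<tau> \<Longrightarrow> \<Gamma> \<turnstile> u \<Colon> \<sigma> \<Longrightarrow> \<Gamma> \<turnstile> t \<bullet> u \<Colon> \<tau>"
| "\<Gamma> \<turnstile> Zero \<Colon> N"
| "\<Gamma> \<turnstile> Succ \<Colon> N \<rightarrow> N"
| "\<Gamma> \<turnstile> Rec \<sigma> \<Colon> \<sigma> \<rightarrow> (N \<rightarrow> \<sigma> \<rightarrow> \<sigma>) \<rightarrow> N \<rightarrow> \<sigma>"
| "\<Gamma> \<turnstile> t \<Colon> \<sigma> \<Longrightarrow> \<Gamma> \<turnstile> u \<Colon> \<tau> \<Longrightarrow> \<Gamma> \<turnstile> Pr t u \<Colon> \<sigma> \<otimes> \<tau>"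
| "\<Gamma> \<turnstile> t \<Colon> \<sigma> \<otimes> \<tau> \<Longrightarrow> \<Gamma> \<turnstile> Fst t \<Colon> \<sigma>"
| "\<Gamma> \<turnstile> t \<Colon> \<sigma> \<otimes> \<tau> \<Longrightarrow> \<Gamma> \<turnstile> Snd t \<Colon> \<tau>"

abbreviation closed_term :: "trm \<Rightarrow> ty \<Rightarrow> bool" where
  "closed_term t \<tau> \<equiv> [] \<turnstile> t \<Colon> \<tau>"


section \<open>Functionals of finite type\<close>

text \<open>
  The full set-theoretic hierarchy over the natural numbers, taken at all finite types at once, does
  not fit into a single HOL type. Terms are therefore interpreted in an arbitrary extensional
  type structure over the (standard) natural numbers: \<open>Dom M \<tau>\<close> is the set of functionals of type
  \<open>\<tau>\<close>, application and projections are operations on the universe \<open>'u\<close>, \<open>num M n\<close> is the number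
  \<open>n\<close>, and \<open>sem M \<Gamma> t \<rho>\<close> is the value of \<open>t\<close> (typed in the context \<open>\<Gamma>\<close>) under the environment
  \<open>\<rho>\<close>. By extensionality, \<open>sem\<close> is determined on typed terms by the remaining components.
  Structures whose carriers are the full function spaces up to any prescribed type level are
  instances (with a large enough \<open>'u\<close>).
\<close>

record 'u tstruct =
  Dom :: "ty \<Rightarrow> 'u set"
  app :: "'u \<Rightarrow> 'u \<Rightarrow> 'u" (infixl "\<cdot>\<index>" 100)
  pr1 :: "'u \<Rightarrow> 'u"
  pr2 :: "'u \<Rightarrow> 'u"
  num :: "nat \<Rightarrow> 'u"
  sem :: "ty list \<Rightarrow> trm \<Rightarrow> 'u list \<Rightarrow> 'u"

definition env :: "('u, 'm) tstruct_scheme \<Rightarrow> ty list \<Rightarrow> 'u list \<Rightarrow> bool" where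
  "env M \<Gamma> \<rho> \<longleftrightarrow> list_all2 (\<lambda>x \<tau>. x \<in> Dom M \<tau>) \<rho> \<Gamma>"

locale T_model =
  fixes M :: "'u tstruct" (structure)
  assumes num_inj: "inj (num M)"
    and Dom_N: "Dom M N = range (num M)"
    and app_Dom: "f \<in> Dom M (\<sigma> \<rightarrow> \<tau>) \<Longrightarrow> x \<in> Dom M \<sigma> \<Longrightarrow> f \<cdot> x \<in> Dom M \<tau>"
    and fun_ext: "f \<in> Dom M (\<sigma> \<rightarrow> \<tau>) \<Longrightarrow> g \<in> Dom M (\<sigma> \<rightarrow> \<tau>) \<Longrightarrow>
      (\<And>x. x \<in> Dom M \<sigma> \<Longrightarrow> f \<cdot> x = g \<cdot> x) \<Longrightarrow> f = g"
    and pr1_Dom: "p \<in> Dom M (\<sigma> \<otimes> \<tau>) \<Longrightarrow> pr1 M p \<in> Dom M \<sigma>"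
    and pr2_Dom: "p \<in> Dom M (\<sigma> \<otimes> \<tau>) \<Longrightarrow> pr2 M p \<in> Dom M \<tau>"
    and prod_ext: "p \<in> Dom M (\<sigma> \<otimes> \<tau>) \<Longrightarrow> q \<in> Dom M (\<sigma> \<otimes> \<tau>) \<Longrightarrow>
      pr1 M p = pr1 M q \<Longrightarrow> pr2 M p = pr2 M q \<Longrightarrow> p = q"
    and sem_Dom: "\<Gamma> \<turnstile> t \<Colon> \<tau> \<Longrightarrow> env M \<Gamma> \<rho> \<Longrightarrow> sem M \<Gamma> t \<rho> \<in> Dom M \<tau>"
    and sem_Var: "env M \<Gamma> \<rho> \<Longrightarrow> i < length \<Gamma> \<Longrightarrow> sem M \<Gamma> (Var i) \<rho> = \<rho> ! i"
    and sem_Lam: "\<sigma> # \<Gamma> \<turnstile> t \<Colon> \<tau> \<Longrightarrow> env M \<Gamma> \<rho> \<Longrightarrow> x \<in> Dom M \<sigma> \<Longrightarrow>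
      sem M \<Gamma> (Lam \<sigma> t) \<rho> \<cdot> x = sem M (\<sigma> # \<Gamma>) t (x # \<rho>)"
    and sem_App: "\<Gamma> \<turnstile> t \<Colon> \<sigma> \<rightarrow> \<tau> \<Longrightarrow> \<Gamma> \<turnstile> u \<Colon> \<sigma> \<Longrightarrow> env M \<Gamma> \<rho> \<Longrightarrow>
      sem M \<Gamma> (t \<bullet> u) \<rho> = sem M \<Gamma> t \<rho> \<cdot> sem M \<Gamma> u \<rho>"
    and sem_Zero: "env M \<Gamma> \<rho> \<Longrightarrow> sem M \<Gamma> Zero \<rho> = num M 0"
    and sem_Succ: "env M \<Gamma> \<rho> \<Longrightarrow> sem M \<Gamma> Succ \<rho> \<cdot> num M n = num M (Suc n)"
    and sem_Rec_0: "env M \<Gamma> \<rho> \<Longrightarrow> a \<in> Dom M \<sigma> \<Longrightarrow> f \<in> Dom M (N \<rightarrow> \<sigma> \<rightarrow> \<sigma>) \<Longrightarrow>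
      sem M \<Gamma> (Rec \<sigma>) \<rho> \<cdot> a \<cdot> f \<cdot> num M 0 = a"
    and sem_Rec_Suc: "env M \<Gamma> \<rho> \<Longrightarrow> a \<in> Dom M \<sigma> \<Longrightarrow> f \<in> Dom M (N \<rightarrow> \<sigma> \<rightarrow> \<sigma>) \<Longrightarrow>
      sem M \<Gamma> (Rec \<sigma>) \<rho> \<cdot> a \<cdot> f \<cdot> num M (Suc n) =
      f \<cdot> num M n \<cdot> (sem M \<Gamma> (Rec \<sigma>) \<rho> \<cdot> a \<cdot> f \<cdot> num M n)"
    and sem_Pr1: "\<Gamma> \<turnstile> t \<Colon> \<sigma> \<Longrightarrow> \<Gamma> \<turnstile> u \<Colon> \<tau> \<Longrightarrow> env M \<Gamma> \<rho> \<Longrightarrow>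
      pr1 M (sem M \<Gamma> (Pr t u) \<rho>) = sem M \<Gamma> t \<rho>"
    and sem_Pr2: "\<Gamma> \<turnstile> t \<Colon> \<sigma> \<Longrightarrow> \<Gamma> \<turnstile> u \<Colon> \<tau> \<Longrightarrow> env M \<Gamma> \<rho> \<Longrightarrow>
      pr2 M (sem M \<Gamma> (Pr t u) \<rho>) = sem M \<Gamma> u \<rho>"
    and sem_Fst: "\<Gamma> \<turnstile> t \<Colon> \<sigma> \<otimes> \<tau> \<Longrightarrow> env M \<Gamma> \<rho> \<Longrightarrow> sem M \<Gamma> (Fst t) \<rho> = pr1 M (sem M \<Gamma> t \<rho>)"
    and sem_Snd: "\<Gamma> \<turnstile> t \<Colon> \<sigma> \<otimes> \<tau> \<Longrightarrow> env M \<Gamma> \<rho> \<Longrightarrow> sem M \<Gamma> (Snd t) \<rho> = pr2 M (sem M \<Gamma> t \<rho>)"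

abbreviation val :: "'u tstruct \<Rightarrow> trm \<Rightarrow> 'u" where
  "val M t \<equiv> sem M [] t []"


section \<open>Booleans and finite sequences encoded in System T\<close>

text \<open>
  Both \<open>\<two>\<close> and the type of finite sequences are encoded as \<open>N\<close>: truth values are 0 and 1, and a
  finite sequence \<open>s\<close> is the number \<open>list_encode s\<close>, which is a bijection between \<open>nat list\<close> and
  \<open>nat\<close>. The terms below compute with these codes; \<open>unpair_t\<close> enumerates the pairs in the order of
  \<open>prod_decode\<close>, and \<open>list_encode (x # xs) = Suc (prod_encode (x, list_encode xs))\<close>.
  Since all of them are closed, they can be used under binders without shifting.
\<close>

abbreviation (input) Two :: ty where "Two \<equiv> N"
abbreviation (input) Sq :: ty where "Sq \<equiv> N"

definition one_t :: trm where
  "one_t = Succ \<bullet> Zero"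

definition pred_t :: trm where
  "pred_t = Lam N (Rec N \<bullet> Zero \<bullet> Lam N (Lam N (Var 1)) \<bullet> Var 0)"

definition minus_t :: trm where
  "minus_t = Lam N (Lam N (Rec N \<bullet> Var 1 \<bullet> Lam N (Lam N (pred_t \<bullet> Var 0)) \<bullet> Var 0))"

definition min_t :: trm where
  "min_t = Lam N (Lam N (minus_t \<bullet> Var 1 \<bullet> (minus_t \<bullet> Var 1 \<bullet> Var 0)))"

text \<open>\<open>if0_t \<tau> \<bullet> c \<bullet> x \<bullet> y\<close> is \<open>x\<close> if \<open>c = 0\<close> and \<open>y\<close> otherwise.\<close>

definition if0_t :: "ty \<Rightarrow> trm" where
  "if0_t \<tau> = Lam N (Lam \<tau> (Lam \<tau> (Rec \<tau> \<bullet> Var 1 \<bullet> Lam N (Lam \<tau> (Var 2)) \<bullet> Var 2)))"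

definition Le_t :: trm where
  "Le_t = Lam N (Lam N (if0_t Two \<bullet> (minus_t \<bullet> Var 0 \<bullet> Var 1) \<bullet> Zero \<bullet> one_t))"

definition unpair_t :: trm where
  "unpair_t = Rec (N \<otimes> N) \<bullet> Pr Zero Zero \<bullet>
     Lam N (Lam (N \<otimes> N)
       (if0_t (N \<otimes> N) \<bullet> Snd (Var 0)
          \<bullet> Pr Zero (Succ \<bullet> Fst (Var 0))
          \<bullet> Pr (Succ \<bullet> Fst (Var 0)) (pred_t \<bullet> Snd (Var 0))))"

definition head_t :: trm where
  "head_t = Lam Sq (Fst (unpair_t \<bullet> (pred_t \<bullet> Var 0)))"

definition tail_t :: trm where
  "tail_t = Lam Sq (Snd (unpair_t \<bullet> (pred_t \<bullet> Var 0)))"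

definition drop_t :: trm where
  "drop_t = Lam Sq (Lam N (Rec Sq \<bullet> Var 1 \<bullet> Lam N (Lam Sq (tail_t \<bullet> Var 0)) \<bullet> Var 0))"

text \<open>The code 0 of the empty sequence has head and tail 0, so indices beyond the length give 0.\<close>

definition hat_t :: trm where
  "hat_t = Lam Sq (Lam N (head_t \<bullet> (drop_t \<bullet> Var 1 \<bullet> Var 0)))"

text \<open>The length of \<open>s\<close> is the number of \<open>i\<close> below the code of \<open>s\<close> such that dropping \<open>i\<close> elements
  from \<open>s\<close> does not give the empty sequence.\<close>

definition len_t :: trm where
  "len_t = Lam Sq (Rec N \<bullet> Zero
     \<bullet> Lam N (Lam N (if0_t N \<bullet> (drop_t \<bullet> Var 2 \<bullet> Var 1) \<bullet> Var 0 \<bullet> (Succ \<bullet> Var 0)))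
     \<bullet> Var 0)"


section \<open>The J-translation\<close>

text \<open>A nucleus is given by the type \<open>J\<close> (for \<open>\<J>\<nat>\<close>) and closed terms \<open>\<eta>\<close> and \<open>\<kappa>\<close>.\<close>

primrec J_ty :: "ty \<Rightarrow> ty \<Rightarrow> ty" where
  "J_ty J N = J"
| "J_ty J (\<sigma> \<rightarrow> \<tau>) = J_ty J \<sigma> \<rightarrow> J_ty J \<tau>"
| "J_ty J (\<sigma> \<otimes> \<tau>) = J_ty J \<sigma> \<otimes> J_ty J \<tau>"

primrec ke :: "ty \<Rightarrow> trm \<Rightarrow> ty \<Rightarrow> trm" where
  "ke J \<kappa> N = \<kappa>"
| "ke J \<kappa> (\<rho> \<rightarrow> \<tau>) =
     Lam (N \<rightarrow> J_ty J (\<rho> \<rightarrow> \<tau>)) (Lam J (Lam (J_ty J \<rho>)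
       (ke J \<kappa> \<tau> \<bullet> Lam N (Var 3 \<bullet> Var 0 \<bullet> Var 1) \<bullet> Var 1)))"
| "ke J \<kappa> (\<rho> \<otimes> \<tau>) =
     Lam (N \<rightarrow> J_ty J (\<rho> \<otimes> \<tau>)) (Lam J
       (Pr (ke J \<kappa> \<rho> \<bullet> Lam N (Fst (Var 2 \<bullet> Var 0)) \<bullet> Var 0)
           (ke J \<kappa> \<tau> \<bullet> Lam N (Snd (Var 2 \<bullet> Var 0)) \<bullet> Var 0)))"

primrec J_trm :: "ty \<Rightarrow> trm \<Rightarrow> trm \<Rightarrow> trm \<Rightarrow> trm" where
  "J_trm J \<eta> \<kappa> (Var i) = Var i"
| "J_trm J \<eta> \<kappa> (Lam \<sigma> t) = Lam (J_ty J \<sigma>) (J_trm J \<eta> \<kappa> t)"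
| "J_trm J \<eta> \<kappa> (t \<bullet> u) = J_trm J \<eta> \<kappa> t \<bullet> J_trm J \<eta> \<kappa> u"
| "J_trm J \<eta> \<kappa> Zero = \<eta> \<bullet> Zero"
| "J_trm J \<eta> \<kappa> Succ = \<kappa> \<bullet> Lam N (\<eta> \<bullet> (Succ \<bullet> Var 0))"
| "J_trm J \<eta> \<kappa> (Rec \<tau>) =
     Lam (J_ty J \<tau>) (Lam (J \<rightarrow> J_ty J \<tau> \<rightarrow> J_ty J \<tau>)
       (ke J \<kappa> \<tau> \<bullet> (Rec (J_ty J \<tau>) \<bullet> Var 1 \<bullet> Lam N (Var 1 \<bullet> (\<eta> \<bullet> Var 0)))))"
| "J_trm J \<eta> \<kappa> (Pr t u) = Pr (J_trm J \<eta> \<kappa> t) (J_trm J \<eta> \<kappa> u)"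
| "J_trm J \<eta> \<kappa> (Fst t) = Fst (J_trm J \<eta> \<kappa> t)"
| "J_trm J \<eta> \<kappa> (Snd t) = Snd (J_trm J \<eta> \<kappa> t)"


section \<open>The nucleus for general bar recursion\<close>

abbreviation (input) G_ty :: "ty \<Rightarrow> ty" where
  "G_ty \<sigma> \<equiv> Sq \<rightarrow> \<sigma>"

abbreviation (input) H_ty :: "ty \<Rightarrow> ty" where
  "H_ty \<sigma> \<equiv> Sq \<rightarrow> (N \<rightarrow> \<sigma>) \<rightarrow> \<sigma>"

abbreviation (input) BR_ty :: "ty \<Rightarrow> ty" where
  "BR_ty \<sigma> \<equiv> G_ty \<sigma> \<rightarrow> H_ty \<sigma> \<rightarrow> Sq \<rightarrow> \<sigma>"

definition JN :: "ty \<Rightarrow> ty" where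
  "JN \<sigma> = ((N \<rightarrow> N) \<rightarrow> N) \<otimes> (Sq \<rightarrow> Two) \<otimes> BR_ty \<sigma>"

abbreviation V_c :: "trm \<Rightarrow> trm" where "V_c w \<equiv> Fst w"
abbreviation S_c :: "trm \<Rightarrow> trm" where "S_c w \<equiv> Fst (Snd w)"
abbreviation B_c :: "trm \<Rightarrow> trm" where "B_c w \<equiv> Snd (Snd w)"

definition eta :: "ty \<Rightarrow> trm" where
  "eta \<sigma> = Lam N
     (Pr (Lam (N \<rightarrow> N) (Var 1))
     (Pr (Lam Sq one_t)
         (Lam (G_ty \<sigma>) (Lam (H_ty \<sigma>) (Var 1)))))"

text \<open>The variables \<open>(g, w)\<close> are \<open>(2, 1)\<close> below \<open>\<lambda>\<alpha>\<close> or \<open>\<lambda>s\<close>, \<open>(3, 2)\<close> below \<open>\<lambda>G H\<close>, and \<open>(4, 3)\<close>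
  below \<open>\<lambda>G H s\<close>.\<close>

definition kappa :: "ty \<Rightarrow> trm" where
  "kappa \<sigma> = Lam (N \<rightarrow> JN \<sigma>) (Lam (JN \<sigma>)
     (Pr (Lam (N \<rightarrow> N) (V_c (Var 2 \<bullet> (V_c (Var 1) \<bullet> Var 0)) \<bullet> Var 0))
     (Pr (Lam Sq (min_t \<bullet> (S_c (Var 1) \<bullet> Var 0)
                        \<bullet> (S_c (Var 2 \<bullet> (V_c (Var 1) \<bullet> (hat_t \<bullet> Var 0))) \<bullet> Var 0)))
         (Lam (G_ty \<sigma>) (Lam (H_ty \<sigma>)
            (B_c (Var 2)
               \<bullet> Lam Sq (B_c (Var 4 \<bullet> (V_c (Var 3) \<bullet> (hat_t \<bullet> Var 0))) \<bullet> Var 2 \<bullet> Var 1 \<bullet> Var 0)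
               \<bullet> Var 0))))))"

definition Omega :: "ty \<Rightarrow> trm \<Rightarrow> trm" where
  "Omega \<sigma> \<Psi> = kappa \<sigma> \<bullet> Lam N
     (Pr (Lam (N \<rightarrow> N) (Var 0 \<bullet> Var 1))
     (Pr (Lam Sq (Le_t \<bullet> Var 1 \<bullet> (len_t \<bullet> Var 0)))
         (\<Psi> \<bullet> Var 0)))"

definition YJ_Omega :: "ty \<Rightarrow> trm \<Rightarrow> trm \<Rightarrow> trm" where
  "YJ_Omega \<sigma> \<Psi> Y = J_trm (JN \<sigma>) (eta \<sigma>) (kappa \<sigma>) Y \<bullet> Omega \<sigma> \<Psi>"


section \<open>Monotonicity, securing, general bar recursion\<close>

abbreviation sq :: "'u tstruct \<Rightarrow> nat list \<Rightarrow> 'u" where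
  "sq M s \<equiv> num M (list_encode s)"

text \<open>The functional \<open>\<lambda>n. F n\<close> of type \<open>N \<rightarrow> \<tau>\<close>; it is used only for functions \<open>F\<close> definable in
  System T from parameters, for which it exists (see
  \<open>hat_eq\<close>, \<open>conc_app\<close>, \<open>lamN_snoc\<close> below) and is unique, by extensionality.\<close>

definition lamN :: "'u tstruct \<Rightarrow> ty \<Rightarrow> (nat \<Rightarrow> 'u) \<Rightarrow> 'u" where
  "lamN M \<tau> F = (THE f. f \<in> Dom M (N \<rightarrow> \<tau>) \<and> (\<forall>n. f \<cdot>\<^bsub>M\<^esub> num M n = F n))"

definition hat :: "'u tstruct \<Rightarrow> nat list \<Rightarrow> 'u" where
  "hat M s = lamN M N (\<lambda>i. if i < length s then num M (s ! i) else num M 0)"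

definition conc :: "'u tstruct \<Rightarrow> nat list \<Rightarrow> 'u \<Rightarrow> 'u" where
  "conc M s \<alpha> =
     lamN M N (\<lambda>i. if i < length s then num M (s ! i) else \<alpha> \<cdot>\<^bsub>M\<^esub> num M (i - length s))"

text \<open>Needed because \<open>\<two>\<close> is encoded as \<open>N\<close>: a predicate on sequences must take the values 0 and 1.\<close>

definition two_valued :: "'u tstruct \<Rightarrow> 'u \<Rightarrow> bool" where
  "two_valued M S \<longleftrightarrow> (\<forall>s. S \<cdot>\<^bsub>M\<^esub> sq M s \<in> {num M 0, num M 1})"

definition holds :: "'u tstruct \<Rightarrow> 'u \<Rightarrow> nat list \<Rightarrow> bool" where
  "holds M S s \<longleftrightarrow> S \<cdot>\<^bsub>M\<^esub> sq M s = num M 1"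

definition monotone_pred :: "'u tstruct \<Rightarrow> 'u \<Rightarrow> bool" where
  "monotone_pred M S \<longleftrightarrow> (\<forall>s n. holds M S s \<longrightarrow> holds M S (s @ [n]))"

definition secures :: "'u tstruct \<Rightarrow> 'u \<Rightarrow> 'u \<Rightarrow> bool" where
  "secures M S Y \<longleftrightarrow>
     (\<forall>s. holds M S s \<longrightarrow> (\<forall>\<alpha> \<in> Dom M (N \<rightarrow> N). Y \<cdot>\<^bsub>M\<^esub> conc M s \<alpha> = Y \<cdot>\<^bsub>M\<^esub> hat M s))"

definition GBR :: "'u tstruct \<Rightarrow> ty \<Rightarrow> 'u \<Rightarrow> 'u \<Rightarrow> bool" where
  "GBR M \<sigma> S \<xi> \<longleftrightarrow>
     (\<forall>G \<in> Dom M (G_ty \<sigma>). \<forall>H \<in> Dom M (H_ty \<sigma>). \<forall>s.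
        (holds M S s \<longrightarrow> \<xi> \<cdot>\<^bsub>M\<^esub> G \<cdot>\<^bsub>M\<^esub> H \<cdot>\<^bsub>M\<^esub> sq M s = G \<cdot>\<^bsub>M\<^esub> sq M s) \<and>
        (\<not> holds M S s \<longrightarrow> \<xi> \<cdot>\<^bsub>M\<^esub> G \<cdot>\<^bsub>M\<^esub> H \<cdot>\<^bsub>M\<^esub> sq M s =
           H \<cdot>\<^bsub>M\<^esub> sq M s \<cdot>\<^bsub>M\<^esub> lamN M \<sigma> (\<lambda>n. \<xi> \<cdot>\<^bsub>M\<^esub> G \<cdot>\<^bsub>M\<^esub> H \<cdot>\<^bsub>M\<^esub> sq M (s @ [n]))))"

definition Psi_spec :: "'u tstruct \<Rightarrow> ty \<Rightarrow> 'u \<Rightarrow> bool" where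
  "Psi_spec M \<sigma> \<Psi> \<longleftrightarrow>
     (\<forall>n. \<forall>G \<in> Dom M (G_ty \<sigma>). \<forall>H \<in> Dom M (H_ty \<sigma>). \<forall>s.
        (n < length s \<longrightarrow> \<Psi> \<cdot>\<^bsub>M\<^esub> num M n \<cdot>\<^bsub>M\<^esub> G \<cdot>\<^bsub>M\<^esub> H \<cdot>\<^bsub>M\<^esub> sq M s = G \<cdot>\<^bsub>M\<^esub> sq M s) \<and>
        (n \<ge> length s \<longrightarrow> \<Psi> \<cdot>\<^bsub>M\<^esub> num M n \<cdot>\<^bsub>M\<^esub> G \<cdot>\<^bsub>M\<^esub> H \<cdot>\<^bsub>M\<^esub> sq M s =
           H \<cdot>\<^bsub>M\<^esub> sq M s \<cdot>\<^bsub>M\<^esub>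
             lamN M \<sigma> (\<lambda>m. \<Psi> \<cdot>\<^bsub>M\<^esub> num M n \<cdot>\<^bsub>M\<^esub> G \<cdot>\<^bsub>M\<^esub> H \<cdot>\<^bsub>M\<^esub> sq M (s @ [m]))))"


section \<open>Correctness of the encodings\<close>

fun tyof :: "ty list \<Rightarrow> trm \<Rightarrow> ty option" where
  "tyof \<Gamma> (Var i) = (if i < length \<Gamma> then Some (\<Gamma> ! i) else None)"
| "tyof \<Gamma> (Lam \<sigma> t) = (case tyof (\<sigma> # \<Gamma>) t of None \<Rightarrow> None | Some \<tau> \<Rightarrow> Some (\<sigma> \<rightarrow> \<tau>))"
| "tyof \<Gamma> (t \<bullet> u) = (case tyof \<Gamma> t of Some (\<sigma> \<rightarrow> \<tau>) \<Rightarrow> (if tyof \<Gamma> u = Some \<sigma> then Some \<tau> else None) | _ \<Rightarrow> None)"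
| "tyof \<Gamma> Zero = Some N"
| "tyof \<Gamma> Succ = Some (N \<rightarrow> N)"
| "tyof \<Gamma> (Rec \<sigma>) = Some (\<sigma> \<rightarrow> (N \<rightarrow> \<sigma> \<rightarrow> \<sigma>) \<rightarrow> N \<rightarrow> \<sigma>)"
| "tyof \<Gamma> (Pr t u) = (case tyof \<Gamma> t of Some \<sigma> \<Rightarrow> (case tyof \<Gamma> u of Some \<tau> \<Rightarrow> Some (\<sigma> \<otimes> \<tau>) | _ \<Rightarrow> None) | _ \<Rightarrow> None)"
| "tyof \<Gamma> (Fst t) = (case tyof \<Gamma> t of Some (\<sigma> \<otimes> \<tau>) \<Rightarrow> Some \<sigma> | _ \<Rightarrow> None)"
| "tyof \<Gamma> (Snd t) = (case tyof \<Gamma> t of Some (\<sigma> \<otimes> \<tau>) \<Rightarrow> Some \<tau> | _ \<Rightarrow> None)"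

lemma typing_tyof: "\<Gamma> \<turnstile> t \<Colon> \<tau> \<Longrightarrow> tyof \<Gamma> t = Some \<tau>"
  by (induction rule: typing.induct) auto

lemma tyof_typing: "tyof \<Gamma> t = Some \<tau> \<Longrightarrow> \<Gamma> \<turnstile> t \<Colon> \<tau>"
  by (induction \<Gamma> t arbitrary: \<tau> rule: tyof.induct)
     (auto intro: typing.intros split: option.splits ty.splits if_splits)

lemma typing_iff: "\<Gamma> \<turnstile> t \<Colon> \<tau> \<longleftrightarrow> tyof \<Gamma> t = Some \<tau>"
  using typing_tyof tyof_typing by blast

lemma tyof_arith1 [simp]:
  "tyof \<Gamma> one_t = Some N" "tyof \<Gamma> pred_t = Some (N \<rightarrow> N)"
  by (auto simp: one_t_def pred_t_def)

lemma tyof_arith2 [simp]: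
  "tyof \<Gamma> minus_t = Some (N \<rightarrow> N \<rightarrow> N)" "tyof \<Gamma> (if0_t \<tau>) = Some (N \<rightarrow> \<tau> \<rightarrow> \<tau> \<rightarrow> \<tau>)"
  by (auto simp: minus_t_def if0_t_def)

lemma tyof_arith3 [simp]:
  "tyof \<Gamma> min_t = Some (N \<rightarrow> N \<rightarrow> N)" "tyof \<Gamma> Le_t = Some (N \<rightarrow> N \<rightarrow> N)"
  "tyof \<Gamma> unpair_t = Some (N \<rightarrow> N \<otimes> N)"
  by (auto simp: min_t_def Le_t_def unpair_t_def)

lemma tyof_seq1 [simp]:
  "tyof \<Gamma> head_t = Some (N \<rightarrow> N)" "tyof \<Gamma> tail_t = Some (N \<rightarrow> N)"
  by (auto simp: head_t_def tail_t_def)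

lemma tyof_seq2 [simp]: "tyof \<Gamma> drop_t = Some (N \<rightarrow> N \<rightarrow> N)"
  by (auto simp: drop_t_def)

lemma tyof_seq3 [simp]:
  "tyof \<Gamma> hat_t = Some (N \<rightarrow> N \<rightarrow> N)" "tyof \<Gamma> len_t = Some (N \<rightarrow> N)"
  by (auto simp: hat_t_def len_t_def)

definition add_t :: trm where
  "add_t = Lam N (Lam N (Rec N \<bullet> Var 1 \<bullet> Lam N (Lam N (Succ \<bullet> Var 0)) \<bullet> Var 0))"

definition tri_t :: trm where
  "tri_t = Lam N (Rec N \<bullet> Zero \<bullet> Lam N (Lam N (add_t \<bullet> Var 0 \<bullet> (Succ \<bullet> Var 1))) \<bullet> Var 0)"

definition cons_t :: trm where
  "cons_t = Lam N (Lam N (Succ \<bullet> (add_t \<bullet> (tri_t \<bullet> (add_t \<bullet> Var 1 \<bullet> Var 0)) \<bullet> Var 1)))"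

definition snoc_t :: trm where
  "snoc_t = Lam Sq (Lam N (Rec N \<bullet> (cons_t \<bullet> Var 0 \<bullet> Zero) \<bullet>
   Lam N (Lam N (cons_t \<bullet> (hat_t \<bullet> Var 3 \<bullet> (minus_t \<bullet> (len_t \<bullet> Var 3) \<bullet> (Succ \<bullet> Var 1))) \<bullet> Var 0)) \<bullet> (len_t \<bullet> Var 1)))"

lemma tyof_add_t [simp]: "tyof \<Gamma> add_t = Some (N \<rightarrow> N \<rightarrow> N)" by (simp add: add_t_def)

lemma tyof_tri_t [simp]: "tyof \<Gamma> tri_t = Some (N \<rightarrow> N)" by (simp add: tri_t_def)

lemma tyof_cons_t [simp]: "tyof \<Gamma> cons_t = Some (N \<rightarrow> N \<rightarrow> N)" by (simp add: cons_t_def)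

lemma tyof_snoc_t [simp]: "tyof \<Gamma> snoc_t = Some (N \<rightarrow> N \<rightarrow> N)" by (simp add: snoc_t_def)

lemma tyof_eta [simp]: "tyof \<Gamma> (eta \<sigma>) = Some (N \<rightarrow> JN \<sigma>)"
  by (auto simp: eta_def JN_def)

lemma tyof_kappa [simp]: "tyof \<Gamma> (kappa \<sigma>) = Some ((N \<rightarrow> JN \<sigma>) \<rightarrow> JN \<sigma> \<rightarrow> JN \<sigma>)"
  by (auto simp: kappa_def JN_def)

lemma tyof_ke [simp]: assumes "\<And>\<Gamma>. tyof \<Gamma> \<kappa> = Some ((N \<rightarrow> J) \<rightarrow> J \<rightarrow> J)"
  shows "tyof \<Gamma> (ke J \<kappa> \<tau>) = Some ((N \<rightarrow> J_ty J \<tau>) \<rightarrow> J \<rightarrow> J_ty J \<tau>)"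
  using assms by (induction \<tau> arbitrary: \<Gamma>) (auto)

lemma tyof_J_trm: assumes "\<And>\<Gamma>. tyof \<Gamma> \<kappa> = Some ((N \<rightarrow> J) \<rightarrow> J \<rightarrow> J)" "\<And>\<Gamma>. tyof \<Gamma> \<eta> = Some (N \<rightarrow> J)"
  shows "\<Gamma> \<turnstile> t \<Colon> \<tau> \<Longrightarrow> tyof (map (J_ty J) \<Gamma>) (J_trm J \<eta> \<kappa> t) = Some (J_ty J \<tau>)"
  by (induction rule: typing.induct) (auto simp: assms)

lemma tyof_weaken: "tyof \<Gamma> t = Some \<tau> \<Longrightarrow> tyof (\<Gamma> @ \<Delta>) t = Some \<tau>"
  by (induction \<Gamma> t arbitrary: \<tau> rule: tyof.induct)
     (auto simp: nth_append split: option.splits ty.splits if_splits)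

lemma closed_YJ_Omega: assumes "closed_term \<Psi> (N \<rightarrow> BR_ty \<sigma>)" "closed_term Y ((N \<rightarrow> N) \<rightarrow> N)"
  shows "closed_term (YJ_Omega \<sigma> \<Psi> Y) (JN \<sigma>)"
  using tyof_J_trm[of "kappa \<sigma>" "JN \<sigma>" "eta \<sigma>" "[]", OF _ _ assms(2)]
   tyof_weaken[of "[]" \<Psi> _ "[N]"] assms(1)
  by (auto simp: typing_iff YJ_Omega_def Omega_def JN_def)

context T_model begin

lemma env_Cons [simp]: "env M (\<sigma> # \<Gamma>) (x # \<rho>) \<longleftrightarrow> x \<in> Dom M \<sigma> \<and> env M \<Gamma> \<rho>"
  by (auto simp: env_def)

lemma env_Nil [simp]: "env M [] []" by (simp add: env_def)

lemma num_Dom [simp]: "num M n \<in> Dom M N" by (simp add: Dom_N)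

lemmas sem_Dom_tyof = sem_Dom[unfolded typing_iff]

lemma sem_one_t [simp]: "env M \<Gamma> \<rho> \<Longrightarrow> sem M \<Gamma> one_t \<rho> = num M 1"
  by (simp add: one_t_def sem_App[of _ _ N N] typing_iff sem_Zero sem_Succ)

lemma sem_eval_App: "tyof \<Gamma> (t \<bullet> u) = Some \<tau> \<Longrightarrow> env M \<Gamma> \<rho> \<Longrightarrow> sem M \<Gamma> (t \<bullet> u) \<rho> = sem M \<Gamma> t \<rho> \<cdot> sem M \<Gamma> u \<rho>"
  by (auto split: option.splits ty.splits if_splits intro!: sem_App simp: typing_iff)

lemma sem_eval_Lam: "tyof \<Gamma> (Lam \<sigma> t) = Some \<tau> \<Longrightarrow> env M \<Gamma> \<rho> \<Longrightarrow> x \<in> Dom M \<sigma> \<Longrightarrow> sem M \<Gamma> (Lam \<sigma> t) \<rho> \<cdot> x = sem M (\<sigma> # \<Gamma>) t (x # \<rho>)"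
  by (auto split: option.splits ty.splits if_splits intro!: sem_Lam simp: typing_iff)

lemma sem_eval_Fst: "tyof \<Gamma> (Fst t) = Some \<tau> \<Longrightarrow> env M \<Gamma> \<rho> \<Longrightarrow> sem M \<Gamma> (Fst t) \<rho> = pr1 M (sem M \<Gamma> t \<rho>)"
  by (auto split: option.splits ty.splits if_splits intro!: sem_Fst simp: typing_iff)

lemma sem_eval_Snd: "tyof \<Gamma> (Snd t) = Some \<tau> \<Longrightarrow> env M \<Gamma> \<rho> \<Longrightarrow> sem M \<Gamma> (Snd t) \<rho> = pr2 M (sem M \<Gamma> t \<rho>)"
  by (auto split: option.splits ty.splits if_splits intro!: sem_Snd simp: typing_iff)

lemma sem_eval_Pr1: "tyof \<Gamma> (Pr t u) = Some \<tau> \<Longrightarrow> env M \<Gamma> \<rho> \<Longrightarrow> pr1 M (sem M \<Gamma> (Pr t u) \<rho>) = sem M \<Gamma> t \<rho>"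
  by (auto split: option.splits ty.splits if_splits intro!: sem_Pr1 simp: typing_iff)

lemma sem_eval_Pr2: "tyof \<Gamma> (Pr t u) = Some \<tau> \<Longrightarrow> env M \<Gamma> \<rho> \<Longrightarrow> pr2 M (sem M \<Gamma> (Pr t u) \<rho>) = sem M \<Gamma> u \<rho>"
  by (auto split: option.splits ty.splits if_splits intro!: sem_Pr2 simp: typing_iff)

lemma sem_eval_Rec_0: "env M \<Gamma> \<rho> \<Longrightarrow> a \<in> Dom M \<sigma> \<Longrightarrow> tyof \<Gamma> f = Some (N \<rightarrow> \<sigma> \<rightarrow> \<sigma>) \<Longrightarrow>
  sem M \<Gamma> (Rec \<sigma>) \<rho> \<cdot> a \<cdot> sem M \<Gamma> f \<rho> \<cdot> num M 0 = a"
  by (auto intro!: sem_Rec_0 sem_Dom_tyof)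

lemma sem_eval_Rec_Suc: "env M \<Gamma> \<rho> \<Longrightarrow> a \<in> Dom M \<sigma> \<Longrightarrow> tyof \<Gamma> f = Some (N \<rightarrow> \<sigma> \<rightarrow> \<sigma>) \<Longrightarrow>
  sem M \<Gamma> (Rec \<sigma>) \<rho> \<cdot> a \<cdot> sem M \<Gamma> f \<rho> \<cdot> num M (Suc n) = sem M \<Gamma> f \<rho> \<cdot> num M n \<cdot> (sem M \<Gamma> (Rec \<sigma>) \<rho> \<cdot> a \<cdot> sem M \<Gamma> f \<rho> \<cdot> num M n)"
  by (auto intro!: sem_Rec_Suc sem_Dom_tyof)

lemma Rec_Dom: "env M \<Gamma> \<rho> \<Longrightarrow> a \<in> Dom M \<sigma> \<Longrightarrow> tyof \<Gamma> f = Some (N \<rightarrow> \<sigma> \<rightarrow> \<sigma>) \<Longrightarrow>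
  sem M \<Gamma> (Rec \<sigma>) \<rho> \<cdot> a \<cdot> sem M \<Gamma> f \<rho> \<cdot> num M n \<in> Dom M \<sigma>"
  by (rule app_Dom[OF app_Dom[OF app_Dom]]) (auto intro!: sem_Dom_tyof)

lemmas sem_eval = sem_eval_App sem_eval_Lam sem_eval_Fst sem_eval_Snd sem_eval_Pr1 sem_eval_Pr2 sem_Var sem_Zero sem_Succ sem_eval_Rec_0 sem_eval_Rec_Suc Rec_Dom sem_Dom_tyof

lemma sem_pred_t: "env M \<Gamma> \<rho> \<Longrightarrow> sem M \<Gamma> pred_t \<rho> \<cdot> num M n = num M (n - 1)"
  by (cases n) (simp_all add: pred_t_def sem_eval)

lemma sem_minus_t: assumes e: "env M \<Gamma> \<rho>" shows "sem M \<Gamma> minus_t \<rho> \<cdot> num M a \<cdot> num M b = num M (a - b)"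
proof -
  let ?\<Gamma> = "N # N # \<Gamma>" and ?\<rho> = "num M b # num M a # \<rho>"
  have "sem M ?\<Gamma> (Rec N) ?\<rho> \<cdot> num M a \<cdot> sem M ?\<Gamma> (Lam N (Lam N (pred_t \<bullet> Var 0))) ?\<rho> \<cdot> num M k = num M (a - k)" for k
    using e by (induction k) (simp_all add: sem_eval sem_pred_t)
  thus ?thesis using e by (simp add: minus_t_def sem_eval)
qed

lemma sem_min_t: "env M \<Gamma> \<rho> \<Longrightarrow> sem M \<Gamma> min_t \<rho> \<cdot> num M a \<cdot> num M b = num M (min a b)"
  by (simp add: min_t_def sem_eval sem_minus_t min_def)

lemma sem_if0_t: "env M \<Gamma> \<rho> \<Longrightarrow> x \<in> Dom M \<tau> \<Longrightarrow> y \<in> Dom M \<tau> \<Longrightarrow>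
   sem M \<Gamma> (if0_t \<tau>) \<rho> \<cdot> num M c \<cdot> x \<cdot> y = (if c = 0 then x else y)"
  by (cases c) (simp_all add: if0_t_def sem_eval)

lemma sem_Le_t: "env M \<Gamma> \<rho> \<Longrightarrow> sem M \<Gamma> Le_t \<rho> \<cdot> num M n \<cdot> num M k = num M (if n < k then 1 else 0)"
  by (simp add: Le_t_def sem_eval sem_minus_t sem_if0_t)

lemma unpair_t_Dom: "env M \<Gamma> \<rho> \<Longrightarrow> sem M \<Gamma> unpair_t \<rho> \<cdot> num M n \<in> Dom M (N \<otimes> N)"
  by (rule app_Dom[of _ N]) (auto intro!: sem_Dom_tyof)

lemma prod_decode_0: "prod_decode 0 = (0, 0)"
  by (simp add: prod_decode_def prod_decode_aux.simps)

lemma sem_unpair_t: assumes e: "env M \<Gamma> \<rho>" shows "pr1 M (sem M \<Gamma> unpair_t \<rho> \<cdot> num M n) = num M (fst (prod_decode n)) \<and>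
   pr2 M (sem M \<Gamma> unpair_t \<rho> \<cdot> num M n) = num M (snd (prod_decode n))"
proof (induction n)
  case 0
  then show ?case using e by (simp add: unpair_t_def sem_eval prod_decode_def prod_decode_aux.simps)
next
  case (Suc n)
  obtain a b where ab: "prod_decode n = (a,b)" by force
  then have n: "n = prod_encode (a,b)" by (metis prod_decode_inverse)
  have s: "prod_decode (Suc n) = (if b = 0 then (0, Suc a) else (Suc a, b - 1))"
  proof -
    have "Suc n = prod_encode (if b = 0 then (0, Suc a) else (Suc a, b - 1))"
      by (cases b) (auto simp: n prod_encode_def)
    thus ?thesis by (metis prod_encode_inverse)
  qed
  show ?case using Suc e unpair_t_Dom[OF e, of n]
    by (simp add: unpair_t_def sem_eval sem_if0_t sem_pred_t ab s)
qed

lemma sem_head_t: "env M \<Gamma> \<rho> \<Longrightarrow> sem M \<Gamma> head_t \<rho> \<cdot> sq M s = num M (case s of [] \<Rightarrow> 0 | x # _ \<Rightarrow> x)"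
  by (cases s) (simp_all add: head_t_def sem_eval sem_pred_t sem_unpair_t prod_decode_0)

lemma sem_tail_t: "env M \<Gamma> \<rho> \<Longrightarrow> sem M \<Gamma> tail_t \<rho> \<cdot> sq M s = sq M (tl s)"
  by (cases s) (simp_all add: tail_t_def sem_eval sem_pred_t sem_unpair_t prod_decode_0)

lemma sem_drop_t: assumes e: "env M \<Gamma> \<rho>" shows "sem M \<Gamma> drop_t \<rho> \<cdot> sq M s \<cdot> num M i = sq M (drop i s)"
proof -
  let ?\<Gamma> = "N # N # \<Gamma>" and ?\<rho> = "num M i # sq M s # \<rho>"
  have "sem M ?\<Gamma> (Rec N) ?\<rho> \<cdot> sq M s \<cdot> sem M ?\<Gamma> (Lam N (Lam N (tail_t \<bullet> Var 0))) ?\<rho> \<cdot> num M k = sq M (drop k s)" for k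
    using e by (induction k) (simp_all add: sem_eval sem_tail_t drop_Suc tl_drop)
  thus ?thesis using e by (simp add: drop_t_def sem_eval)
qed

lemma sem_hat_t: "env M \<Gamma> \<rho> \<Longrightarrow> sem M \<Gamma> hat_t \<rho> \<cdot> sq M s \<cdot> num M i = num M (if i < length s then s ! i else 0)"
  by (auto simp add: hat_t_def sem_eval sem_drop_t sem_head_t split: list.splits simp flip: hd_drop_conv_nth)

lemma length_le_list_encode: "length s \<le> list_encode s"
  by (induction s) (auto intro: order_trans[OF _ le_prod_encode_2])

lemma list_encode_eq_0: "list_encode s = 0 \<longleftrightarrow> s = []" by (cases s) auto

lemma sem_len_t: assumes e: "env M \<Gamma> \<rho>" shows "sem M \<Gamma> len_t \<rho> \<cdot> sq M s = num M (length s)"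
proof -
  let ?\<Gamma> = "N # \<Gamma>" and ?\<rho> = "sq M s # \<rho>"
  let ?f = "Lam N (Lam N (if0_t N \<bullet> (drop_t \<bullet> Var 2 \<bullet> Var 1) \<bullet> Var 0 \<bullet> (Succ \<bullet> Var 0)))"
  have "sem M ?\<Gamma> (Rec N) ?\<rho> \<cdot> num M 0 \<cdot> sem M ?\<Gamma> ?f ?\<rho> \<cdot> num M k = num M (min k (length s))" for k
  proof (induction k)
    case 0
    show ?case using e by (simp add: sem_eval)
  next
    case (Suc k)
    show ?case using e Suc by (simp add: sem_eval sem_drop_t sem_if0_t list_encode_eq_0 min_def)
  qed
  then have "sem M ?\<Gamma> (Rec N) ?\<rho> \<cdot> num M 0 \<cdot> sem M ?\<Gamma> ?f ?\<rho> \<cdot> sq M s = num M (length s)"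
    using length_le_list_encode[of s] by (simp add: min_absorb2)
  then show ?thesis using e by (simp add: len_t_def sem_eval)
qed

lemma lamN_eq:
  assumes "f \<in> Dom M (N \<rightarrow> \<tau>)" "\<And>n. f \<cdot> num M n = F n"
  shows "lamN M \<tau> F = f"
  unfolding lamN_def
proof (rule the_equality)
  show "f \<in> Dom M (N \<rightarrow> \<tau>) \<and> (\<forall>n. f \<cdot> num M n = F n)" using assms by simp
next
  fix g assume g: "g \<in> Dom M (N \<rightarrow> \<tau>) \<and> (\<forall>n. g \<cdot> num M n = F n)"
  show "g = f"
    by (rule fun_ext[of _ N \<tau>]) (use g assms Dom_N in auto)
qed

lemma sem_add_t: assumes e: "env M \<Gamma> \<rho>" shows "sem M \<Gamma> add_t \<rho> \<cdot> num M a \<cdot> num M b = num M (a + b)"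
proof -
  let ?\<Gamma> = "N # N # \<Gamma>" and ?\<rho> = "num M b # num M a # \<rho>"
  have "sem M ?\<Gamma> (Rec N) ?\<rho> \<cdot> num M a \<cdot> sem M ?\<Gamma> (Lam N (Lam N (Succ \<bullet> Var 0))) ?\<rho> \<cdot> num M k = num M (a + k)" for k
    using e by (induction k) (simp_all add: sem_eval)
  thus ?thesis using e by (simp add: add_t_def sem_eval)
qed

lemma sem_tri_t: assumes e: "env M \<Gamma> \<rho>" shows "sem M \<Gamma> tri_t \<rho> \<cdot> num M b = num M (triangle b)"
proof -
  let ?\<Gamma> = "N # \<Gamma>" and ?\<rho> = "num M b # \<rho>"
  have "sem M ?\<Gamma> (Rec N) ?\<rho> \<cdot> num M 0 \<cdot> sem M ?\<Gamma> (Lam N (Lam N (add_t \<bullet> Var 0 \<bullet> (Succ \<bullet> Var 1)))) ?\<rho> \<cdot> num M k = num M (triangle k)" for k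
    using e by (induction k) (simp_all add: sem_eval sem_add_t)
  thus ?thesis using e by (simp add: tri_t_def sem_eval)
qed

lemma sem_cons_t: "env M \<Gamma> \<rho> \<Longrightarrow> sem M \<Gamma> cons_t \<rho> \<cdot> num M a \<cdot> sq M s = sq M (a # s)"
  by (simp add: cons_t_def sem_eval sem_add_t sem_tri_t prod_encode_def)

lemma sem_cons_t_0: "env M \<Gamma> \<rho> \<Longrightarrow> sem M \<Gamma> cons_t \<rho> \<cdot> num M a \<cdot> num M 0 = sq M [a]"
  using sem_cons_t[of \<Gamma> \<rho> a "[]"] by simp

lemma sem_snoc_t: assumes e: "env M \<Gamma> \<rho>" shows "sem M \<Gamma> snoc_t \<rho> \<cdot> sq M s \<cdot> num M n = sq M (s @ [n])"
proof -
  let ?\<Gamma> = "N # N # \<Gamma>" and ?\<rho> = "num M n # sq M s # \<rho>"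
  let ?f = "Lam N (Lam N (cons_t \<bullet> (hat_t \<bullet> Var 3 \<bullet> (minus_t \<bullet> (len_t \<bullet> Var 3) \<bullet> (Succ \<bullet> Var 1))) \<bullet> Var 0))"
  have "k \<le> length s \<Longrightarrow> sem M ?\<Gamma> (Rec N) ?\<rho> \<cdot> sq M [n] \<cdot> sem M ?\<Gamma> ?f ?\<rho> \<cdot> num M k = sq M (drop (length s - k) s @ [n])" for k
  proof (induction k)
    case 0 then show ?case using e by (simp add: sem_eval del: list_encode.simps)
  next
    case (Suc k)
    then have "drop (length s - Suc k) s = s ! (length s - Suc k) # drop (length s - k) s"
      by (metis Cons_nth_drop_Suc Suc_diff_Suc Suc_le_lessD diff_less length_greater_0_conv list.size(3) not_less_zero zero_less_Suc)
    moreover have "length s - Suc k < length s"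
      using Suc.prems by simp
    moreover have "sem M ?\<Gamma> (Rec N) ?\<rho> \<cdot> sq M [n] \<cdot> sem M ?\<Gamma> ?f ?\<rho> \<cdot> num M k = sq M (drop (length s - k) s @ [n])"
      using Suc by simp
    ultimately show ?case
      using e by (simp add: sem_eval sem_hat_t sem_len_t sem_minus_t sem_cons_t del: list_encode.simps)
  qed
  from this[of "length s"] show ?thesis using e by (simp add: snoc_t_def sem_eval sem_len_t sem_cons_t_0 del: list_encode.simps)
qed

lemma lamN_snoc: assumes "x \<in> Dom M (Sq \<rightarrow> \<tau>)"
  shows "lamN M \<tau> (\<lambda>n. x \<cdot> sq M (s @ [n])) \<in> Dom M (N \<rightarrow> \<tau>)"
   "lamN M \<tau> (\<lambda>n. x \<cdot> sq M (s @ [n])) \<cdot> num M n = x \<cdot> sq M (s @ [n])"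
proof -
  let ?f = "sem M [Sq, Sq \<rightarrow> \<tau>] (Lam N (Var 2 \<bullet> (snoc_t \<bullet> Var 1 \<bullet> Var 0))) [sq M s, x]"
  have "lamN M \<tau> (\<lambda>n. x \<cdot> sq M (s @ [n])) = ?f"
    using assms by (intro lamN_eq) (simp_all add: sem_eval sem_snoc_t)
  then show "lamN M \<tau> (\<lambda>n. x \<cdot> sq M (s @ [n])) \<in> Dom M (N \<rightarrow> \<tau>)"
   "lamN M \<tau> (\<lambda>n. x \<cdot> sq M (s @ [n])) \<cdot> num M n = x \<cdot> sq M (s @ [n])"
    using assms by (simp_all add: sem_eval sem_snoc_t)
qed

lemma hat_eq: "hat M s = val M hat_t \<cdot> sq M s"
  unfolding hat_def by (rule lamN_eq) (auto intro!: app_Dom[of _ N] sem_Dom_tyof simp: sem_hat_t)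

lemma conc_app: assumes "\<alpha> \<in> Dom M (N \<rightarrow> N)"
  shows "conc M s \<alpha> \<in> Dom M (N \<rightarrow> N) \<and> conc M s \<alpha> \<cdot> num M i = (if i < length s then num M (s ! i) else \<alpha> \<cdot> num M (i - length s))"
proof -
  let ?f = "sem M [Sq, N \<rightarrow> N] (Lam N (if0_t N \<bullet> (Le_t \<bullet> Var 0 \<bullet> (len_t \<bullet> Var 1)) \<bullet> (Var 2 \<bullet> (minus_t \<bullet> Var 0 \<bullet> (len_t \<bullet> Var 1))) \<bullet> (hat_t \<bullet> Var 1 \<bullet> Var 0))) [sq M s, \<alpha>]"
  have a: "\<alpha> \<cdot> num M i \<in> Dom M N" for i using assms by (auto intro: app_Dom)
  have "conc M s \<alpha> = ?f"
    using assms unfolding conc_def by (intro lamN_eq) (simp_all add: sem_eval sem_hat_t sem_Le_t sem_if0_t sem_len_t sem_minus_t a)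
  then show ?thesis
    using assms by (simp_all add: sem_eval sem_hat_t sem_Le_t sem_if0_t sem_len_t sem_minus_t a)
qed
end

end

theory Submission
  imports Defs
begin

text \<open>
  A logical relation links a family of functionals \<open>f \<alpha>\<close> of type \<open>\<tau>\<close>, indexed by
  \<open>\<alpha> : N \<rightarrow> N\<close>, with an element of the translated type. At \<open>N\<close> it says that the first component
  of \<open>w\<close> computes \<open>f \<alpha>\<close>, that the second is monotone and secures the first, and that the third
  performs bar recursion for the second. The nucleus operations preserve these properties: where
  \<open>S\<^sub>w\<close> holds, \<open>V\<^sub>w\<close> is constant, so that \<open>g (V\<^sub>w \<alpha>)\<close> no longer changes as the sequence grows, and
  bar recursion for \<open>\<kappa> g w\<close> is bar recursion for \<open>w\<close> whose leaves continue with the recursion for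
  \<open>g (V\<^sub>w \<alpha>)\<close>. Since \<open>\<Omega>\<close> is related to the identity family \<open>\<lambda>\<alpha>. \<alpha>\<close>, the translation of \<open>Y\<close>
  applied to \<open>\<Omega>\<close> is related to \<open>\<lambda>\<alpha>. Y \<alpha>\<close>.
\<close>

section \<open>The logical relation\<close>

definition bar_nucleus :: "'u tstruct \<Rightarrow> ty \<Rightarrow> 'u \<Rightarrow> bool" where
  "bar_nucleus M \<sigma> w \<longleftrightarrow>
     two_valued M (pr1 M (pr2 M w)) \<and> monotone_pred M (pr1 M (pr2 M w)) \<and>
     secures M (pr1 M (pr2 M w)) (pr1 M w) \<and>
     GBR M \<sigma> (pr1 M (pr2 M w)) (pr2 M (pr2 M w))"

text \<open>The family \<open>f\<close> is an arbitrary HOL function rather than an element of the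
  model, so it need not be definable in \<open>\<alpha>\<close>, and only its values on
  \<open>Dom M (N \<rightarrow> N)\<close> count. At \<open>N\<close>, membership of these values in
  \<open>Dom M N\<close> follows from the type of the first component of \<open>w\<close>; at the
  other types the clauses on arguments and projections alone do not give membership, so it is
  required explicitly.\<close>

primrec tracks :: "'u tstruct \<Rightarrow> ty \<Rightarrow> ty \<Rightarrow> ('u \<Rightarrow> 'u) \<Rightarrow> 'u \<Rightarrow> bool" where
  "tracks M \<sigma> N f w \<longleftrightarrow>
     w \<in> Dom M (JN \<sigma>) \<and> (\<forall>\<alpha> \<in> Dom M (N \<rightarrow> N). pr1 M w \<cdot>\<^bsub>M\<^esub> \<alpha> = f \<alpha>) \<and> bar_nucleus M \<sigma> w"
| "tracks M \<sigma> (\<rho> \<rightarrow> \<tau>) f h \<longleftrightarrow>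
     (\<forall>\<alpha> \<in> Dom M (N \<rightarrow> N). f \<alpha> \<in> Dom M (\<rho> \<rightarrow> \<tau>)) \<and> h \<in> Dom M (J_ty (JN \<sigma>) (\<rho> \<rightarrow> \<tau>)) \<and>
     (\<forall>x a. tracks M \<sigma> \<rho> x a \<longrightarrow> tracks M \<sigma> \<tau> (\<lambda>\<alpha>. f \<alpha> \<cdot>\<^bsub>M\<^esub> x \<alpha>) (h \<cdot>\<^bsub>M\<^esub> a))"
| "tracks M \<sigma> (\<rho> \<otimes> \<tau>) f p \<longleftrightarrow>
     (\<forall>\<alpha> \<in> Dom M (N \<rightarrow> N). f \<alpha> \<in> Dom M (\<rho> \<otimes> \<tau>)) \<and> p \<in> Dom M (J_ty (JN \<sigma>) (\<rho> \<otimes> \<tau>)) \<and>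
     tracks M \<sigma> \<rho> (\<lambda>\<alpha>. pr1 M (f \<alpha>)) (pr1 M p) \<and> tracks M \<sigma> \<tau> (\<lambda>\<alpha>. pr2 M (f \<alpha>)) (pr2 M p)"

definition tracks_env ::
    "'u tstruct \<Rightarrow> ty \<Rightarrow> ty list \<Rightarrow> ('u \<Rightarrow> 'u) list \<Rightarrow> 'u list \<Rightarrow> bool" where
  "tracks_env M \<sigma> \<Gamma> fs ws \<longleftrightarrow> length fs = length \<Gamma> \<and> length ws = length \<Gamma> \<and>
     (\<forall>i < length \<Gamma>. tracks M \<sigma> (\<Gamma> ! i) (fs ! i) (ws ! i))"

lemma tyof_closed: "closed_term t \<tau> \<Longrightarrow> tyof \<Gamma> t = Some \<tau>"
  using tyof_weaken[of "[]" t \<tau> \<Gamma>] by (simp add: typing_iff)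

context T_model begin

section \<open>Numerals, environments and weakening in a model\<close>

lemma Dom_N_cases: assumes "x \<in> Dom M N" obtains n where "x = num M n"
  using assms Dom_N by auto

lemma num_eq_iff [simp]: "num M m = num M n \<longleftrightarrow> m = n"
  using num_inj by (auto dest: injD)

lemma env_append: "env M \<Gamma> \<rho> \<Longrightarrow> env M \<Delta> \<rho>' \<Longrightarrow> env M (\<Gamma> @ \<Delta>) (\<rho> @ \<rho>')"
  by (simp add: env_def list_all2_appendI)

lemma env_length: "env M \<Gamma> \<rho> \<Longrightarrow> length \<rho> = length \<Gamma>"
  by (simp add: env_def list_all2_lengthD)

text \<open>The axioms fix the recursor in each environment only through its two equations.
  Induction on the numeral shows that these have a single solution, and extensionality at the three
  arrows lifts this to the recursor itself.\<close>

lemma sem_Rec_env: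
  assumes "env M \<Gamma> \<rho>" "env M \<Delta> \<rho>'"
  shows "sem M \<Gamma> (Rec \<sigma>) \<rho> = sem M \<Delta> (Rec \<sigma>) \<rho>'"
proof -
  have D: "sem M \<Gamma> (Rec \<sigma>) \<rho> \<in> Dom M (\<sigma> \<rightarrow> (N \<rightarrow> \<sigma> \<rightarrow> \<sigma>) \<rightarrow> N \<rightarrow> \<sigma>)"
      "sem M \<Delta> (Rec \<sigma>) \<rho>' \<in> Dom M (\<sigma> \<rightarrow> (N \<rightarrow> \<sigma> \<rightarrow> \<sigma>) \<rightarrow> N \<rightarrow> \<sigma>)"
    using assms by (auto intro!: sem_Dom_tyof)
  show ?thesis
  proof (rule fun_ext[OF D], rule fun_ext[OF app_Dom[OF D(1)] app_Dom[OF D(2)]])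
    fix a f assume a: "a \<in> Dom M \<sigma>" and f: "f \<in> Dom M (N \<rightarrow> \<sigma> \<rightarrow> \<sigma>)"
    have "sem M \<Gamma> (Rec \<sigma>) \<rho> \<cdot> a \<cdot> f \<cdot> num M n = sem M \<Delta> (Rec \<sigma>) \<rho>' \<cdot> a \<cdot> f \<cdot> num M n" for n
      using assms a f by (induction n) (simp_all add: sem_Rec_0 sem_Rec_Suc)
    then show "sem M \<Gamma> (Rec \<sigma>) \<rho> \<cdot> a \<cdot> f = sem M \<Delta> (Rec \<sigma>) \<rho>' \<cdot> a \<cdot> f"
      by (intro fun_ext[OF app_Dom[OF app_Dom[OF D(1) a] f] app_Dom[OF app_Dom[OF D(2) a] f]])
        (auto elim!: Dom_N_cases)
  qed
qed

text \<open>Entries are appended at the far end, so de Bruijn indices stay the same. The axioms fix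
  abstractions and \<open>Succ\<close> only under application, and pairs only under projection;
  there extensionality closes the gap. The purpose is to evaluate the unknown closed term
  \<open>\<Psi>\<close> below the binder in \<open>Omega\<close>.\<close>

lemma sem_weaken:
  assumes "\<Gamma> \<turnstile> t \<Colon> \<tau>" "env M \<Gamma> \<rho>" "env M \<Delta> \<rho>'"
  shows "sem M (\<Gamma> @ \<Delta>) t (\<rho> @ \<rho>') = sem M \<Gamma> t \<rho>"
  using assms
proof (induction arbitrary: \<rho> rule: typing.induct)
  case (1 i \<Gamma>)
  then show ?case by (simp add: sem_Var env_append env_length nth_append)
next
  case (2 \<sigma> \<Gamma> t \<tau>)
  have ty: "\<Gamma> @ \<Delta> \<turnstile> Lam \<sigma> t \<Colon> \<sigma> \<rightarrow> \<tau>" "\<Gamma> \<turnstile> Lam \<sigma> t \<Colon> \<sigma> \<rightarrow> \<tau>"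
      "\<sigma> # \<Gamma> @ \<Delta> \<turnstile> t \<Colon> \<tau>"
    using 2(1) tyof_weaken[of "\<sigma> # \<Gamma>" t \<tau> \<Delta>] by (auto simp: typing_iff)
  show ?case
  proof (rule fun_ext[OF sem_Dom[OF ty(1)] sem_Dom[OF ty(2)]])
    fix x assume x: "x \<in> Dom M \<sigma>"
    then show "sem M (\<Gamma> @ \<Delta>) (Lam \<sigma> t) (\<rho> @ \<rho>') \<cdot> x = sem M \<Gamma> (Lam \<sigma> t) \<rho> \<cdot> x"
      using 2(2)[of "x # \<rho>"] 2 ty(3) by (simp add: sem_Lam env_append)
  qed (use 2 in \<open>auto intro: env_append\<close>)
next
  case (3 \<Gamma> t \<sigma> \<tau> u)
  have "\<Gamma> @ \<Delta> \<turnstile> t \<Colon> \<sigma> \<rightarrow> \<tau>" "\<Gamma> @ \<Delta> \<turnstile> u \<Colon> \<sigma>"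
    using 3(1,2) tyof_weaken by (auto simp: typing_iff)
  then show ?case using 3 by (simp add: sem_App[of _ _ \<sigma> \<tau>] env_append)
next
  case (4 \<Gamma>)
  then show ?case by (simp add: sem_Zero env_append)
next
  case (5 \<Gamma>)
  show ?case
    by (rule fun_ext[of _ N N])
      (use 5 in \<open>auto intro!: sem_Dom_tyof env_append elim!: Dom_N_cases simp: sem_Succ env_append\<close>)
next
  case (6 \<Gamma> \<sigma>)
  then show ?case by (intro sem_Rec_env env_append)
next
  case (7 \<Gamma> t \<sigma> u \<tau>)
  have ty: "\<Gamma> @ \<Delta> \<turnstile> t \<Colon> \<sigma>" "\<Gamma> @ \<Delta> \<turnstile> u \<Colon> \<tau>"
    using 7(1,2) tyof_weaken by (auto simp: typing_iff)
  show ?case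
    by (rule prod_ext[of _ \<sigma> \<tau>])
      (use 7 ty in \<open>auto intro!: sem_Dom env_append typing.intros
         simp: sem_Pr1[of _ _ \<sigma> _ \<tau>] sem_Pr2[of _ _ \<sigma> _ \<tau>] env_append\<close>)
next
  case (8 \<Gamma> t \<sigma> \<tau>)
  have "\<Gamma> @ \<Delta> \<turnstile> t \<Colon> \<sigma> \<otimes> \<tau>"
    using 8(1) tyof_weaken by (auto simp: typing_iff)
  then show ?case using 8 by (simp add: sem_Fst[of _ _ \<sigma> \<tau>] env_append)
next
  case (9 \<Gamma> t \<sigma> \<tau>)
  have "\<Gamma> @ \<Delta> \<turnstile> t \<Colon> \<sigma> \<otimes> \<tau>"
    using 9(1) tyof_weaken by (auto simp: typing_iff)
  then show ?case using 9 by (simp add: sem_Snd[of _ _ \<sigma> \<tau>] env_append)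
qed

lemma sem_closed: "closed_term t \<tau> \<Longrightarrow> env M \<Gamma> \<rho> \<Longrightarrow> sem M \<Gamma> t \<rho> = val M t"
  using sem_weaken[of "[]" t \<tau> "[]" \<Gamma> \<rho>] by simp

section \<open>Zero extensions of finite sequences\<close>

lemma sem_hat: assumes "env M \<Gamma> \<rho>" shows "sem M \<Gamma> hat_t \<rho> \<cdot> sq M s = hat M s"
  unfolding hat_def
  by (rule lamN_eq[symmetric])
    (use assms in \<open>auto intro!: app_Dom[of _ N] sem_Dom_tyof simp: sem_hat_t\<close>)

lemma hat_Dom [simp]: "hat M s \<in> Dom M (N \<rightarrow> N)"
  unfolding hat_eq by (auto intro!: app_Dom[of _ N] sem_Dom_tyof)

lemma hat_app: "hat M s \<cdot> num M i = num M (if i < length s then s ! i else 0)"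
  unfolding hat_eq by (simp add: sem_hat_t)

text \<open>Securing speaks of concatenations with \<open>s\<close> only; in this form the zero
  extension of a longer sequence becomes one of them.\<close>

lemma hat_snoc: "hat M (s @ [n]) = conc M s (hat M [n])"
proof -
  have "(\<lambda>i. if i < length (s @ [n]) then num M ((s @ [n]) ! i) else num M 0) =
      (\<lambda>i. if i < length s then num M (s ! i) else hat M [n] \<cdot> num M (i - length s))"
    by (auto simp: fun_eq_iff hat_app nth_append)
  then show ?thesis by (simp add: hat_def[of M "s @ [n]"] conc_def)
qed

lemma secures_snoc:
  assumes "secures M S Y" "holds M S s"
  shows "Y \<cdot> hat M (s @ [n]) = Y \<cdot> hat M s"
  using assms unfolding secures_def hat_snoc by simp

section \<open>Components of the nucleus terms\<close>

lemma JN_Dom: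
  assumes "w \<in> Dom M (JN \<sigma>)"
  shows "pr1 M w \<in> Dom M ((N \<rightarrow> N) \<rightarrow> N)" "pr1 M (pr2 M w) \<in> Dom M (N \<rightarrow> N)"
    "pr2 M (pr2 M w) \<in> Dom M (BR_ty \<sigma>)"
  using assms unfolding JN_def by (blast intro: pr1_Dom pr2_Dom)+

lemma V_app_cases:
  assumes "w \<in> Dom M (JN \<sigma>)" "\<alpha> \<in> Dom M (N \<rightarrow> N)"
  obtains n where "pr1 M w \<cdot> \<alpha> = num M n"
  using app_Dom[OF JN_Dom(1)[OF assms(1)] assms(2)] by (rule Dom_N_cases)

lemma sem_eta:
  assumes "env M \<Gamma> \<rho>"
  shows "\<alpha> \<in> Dom M (N \<rightarrow> N) \<Longrightarrow> pr1 M (sem M \<Gamma> (eta \<sigma>) \<rho> \<cdot> num M n) \<cdot> \<alpha> = num M n"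
    "pr1 M (pr2 M (sem M \<Gamma> (eta \<sigma>) \<rho> \<cdot> num M n)) \<cdot> num M k = num M 1"
    "G \<in> Dom M (G_ty \<sigma>) \<Longrightarrow> H \<in> Dom M (H_ty \<sigma>) \<Longrightarrow>
       pr2 M (pr2 M (sem M \<Gamma> (eta \<sigma>) \<rho> \<cdot> num M n)) \<cdot> G \<cdot> H = G"
  using assms by (simp_all add: eta_def sem_eval)

lemma eta_Dom: "env M \<Gamma> \<rho> \<Longrightarrow> sem M \<Gamma> (eta \<sigma>) \<rho> \<cdot> num M n \<in> Dom M (JN \<sigma>)"
  by (rule app_Dom[of _ N]) (auto intro: sem_Dom_tyof)

lemma kappa_Dom:
  "env M \<Gamma> \<rho> \<Longrightarrow> g \<in> Dom M (N \<rightarrow> JN \<sigma>) \<Longrightarrow> w \<in> Dom M (JN \<sigma>) \<Longrightarrow>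
    sem M \<Gamma> (kappa \<sigma>) \<rho> \<cdot> g \<cdot> w \<in> Dom M (JN \<sigma>)"
  by (rule app_Dom[OF app_Dom]) (auto intro: sem_Dom_tyof)

text \<open>The second clause takes numerals \<open>a\<close> and \<open>b\<close> because
  \<open>min_t\<close> computes on numerals. The third hides the syntax of the leaf functional that
  \<open>kappa\<close> hands to the recursion of \<open>w\<close>: all that matters is that it
  exists in the model and how it acts on codes of sequences.\<close>

lemma sem_kappa:
  fixes \<sigma> g w
  assumes env: "env M \<Gamma> \<rho>" and g: "g \<in> Dom M (N \<rightarrow> JN \<sigma>)" and w: "w \<in> Dom M (JN \<sigma>)"
  defines "k \<equiv> sem M \<Gamma> (kappa \<sigma>) \<rho> \<cdot> g \<cdot> w"
  shows "\<alpha> \<in> Dom M (N \<rightarrow> N) \<Longrightarrow> pr1 M k \<cdot> \<alpha> = pr1 M (g \<cdot> (pr1 M w \<cdot> \<alpha>)) \<cdot> \<alpha>"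
    and "pr1 M (pr2 M w) \<cdot> sq M s = num M a \<Longrightarrow>
       pr1 M (pr2 M (g \<cdot> (pr1 M w \<cdot> hat M s))) \<cdot> sq M s = num M b \<Longrightarrow>
       pr1 M (pr2 M k) \<cdot> sq M s = num M (min a b)"
    and "G \<in> Dom M (G_ty \<sigma>) \<Longrightarrow> H \<in> Dom M (H_ty \<sigma>) \<Longrightarrow>
       \<exists>G' \<in> Dom M (G_ty \<sigma>).
         (\<forall>s. G' \<cdot> sq M s = pr2 M (pr2 M (g \<cdot> (pr1 M w \<cdot> hat M s))) \<cdot> G \<cdot> H \<cdot> sq M s) \<and>
         pr2 M (pr2 M k) \<cdot> G \<cdot> H = pr2 M (pr2 M w) \<cdot> G' \<cdot> H"
proof -
  \<comment> \<open>The evaluation rules compute types, and projections are typable only where the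
    product behind \<open>JN\<close> is visible.\<close>
  note D = g[unfolded JN_def] w[unfolded JN_def]
  show "\<alpha> \<in> Dom M (N \<rightarrow> N) \<Longrightarrow> pr1 M k \<cdot> \<alpha> = pr1 M (g \<cdot> (pr1 M w \<cdot> \<alpha>)) \<cdot> \<alpha>"
    using env D by (simp add: k_def kappa_def JN_def sem_eval)
  show "pr1 M (pr2 M w) \<cdot> sq M s = num M a \<Longrightarrow>
       pr1 M (pr2 M (g \<cdot> (pr1 M w \<cdot> hat M s))) \<cdot> sq M s = num M b \<Longrightarrow>
       pr1 M (pr2 M k) \<cdot> sq M s = num M (min a b)"
    using env D by (simp add: k_def kappa_def JN_def sem_eval sem_hat sem_min_t)
  assume G: "G \<in> Dom M (G_ty \<sigma>)" and H: "H \<in> Dom M (H_ty \<sigma>)"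
  \<comment> \<open>The inner abstraction of \<open>kappa\<close>, evaluated where \<open>H\<close>,
    \<open>G\<close>, \<open>w\<close>, \<open>g\<close> are the variables 0 to 3; its own binder
    shifts them by one.\<close>
  let ?G = "sem M (H_ty \<sigma> # G_ty \<sigma> # JN \<sigma> # (N \<rightarrow> JN \<sigma>) # \<Gamma>)
    (Lam Sq (B_c (Var 4 \<bullet> (V_c (Var 3) \<bullet> (hat_t \<bullet> Var 0))) \<bullet> Var 2 \<bullet> Var 1 \<bullet> Var 0))
    (H # G # w # g # \<rho>)"
  show "\<exists>G' \<in> Dom M (G_ty \<sigma>).
         (\<forall>s. G' \<cdot> sq M s = pr2 M (pr2 M (g \<cdot> (pr1 M w \<cdot> hat M s))) \<cdot> G \<cdot> H \<cdot> sq M s) \<and>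
         pr2 M (pr2 M k) \<cdot> G \<cdot> H = pr2 M (pr2 M w) \<cdot> G' \<cdot> H"
  proof (intro bexI conjI allI)
    show "?G \<in> Dom M (G_ty \<sigma>)"
      using env D G H by (intro sem_Dom_tyof) (simp_all add: JN_def)
    show "?G \<cdot> sq M s = pr2 M (pr2 M (g \<cdot> (pr1 M w \<cdot> hat M s))) \<cdot> G \<cdot> H \<cdot> sq M s" for s
      using env D G H by (simp add: JN_def sem_eval sem_hat)
    show "pr2 M (pr2 M k) \<cdot> G \<cdot> H = pr2 M (pr2 M w) \<cdot> ?G \<cdot> H"
      using env D G H by (simp add: k_def kappa_def JN_def sem_eval)
  qed
qed

section \<open>Preservation of securing and bar recursion by the nucleus\<close>

text \<open>Every sequence is a leaf, which is sound because the first component is constant;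
  accordingly the recursion returns \<open>G\<close> at once.\<close>

lemma bar_nucleus_eta:
  assumes "env M \<Gamma> \<rho>" shows "bar_nucleus M \<sigma> (sem M \<Gamma> (eta \<sigma>) \<rho> \<cdot> num M n)"
  using assms
  by (auto simp: bar_nucleus_def two_valued_def monotone_pred_def secures_def GBR_def holds_def
      sem_eta conc_app)

text \<open>Before the bar of \<open>w\<close> is reached, the recursion unwinds that of
  \<open>w\<close>; from there on it is the recursion of one fixed element
  \<open>g \<cdot> num M n\<close>. Numerals suffice in the hypothesis on \<open>g\<close>, since
  the first component of \<open>w\<close> takes numeral values.\<close>

lemma bar_nucleus_kappa:
  assumes env: "env M \<Gamma> \<rho>" and g: "g \<in> Dom M (N \<rightarrow> JN \<sigma>)" and w: "w \<in> Dom M (JN \<sigma>)"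
    and bn_w: "bar_nucleus M \<sigma> w" and bn_g: "\<And>n. bar_nucleus M \<sigma> (g \<cdot> num M n)"
  shows "bar_nucleus M \<sigma> (sem M \<Gamma> (kappa \<sigma>) \<rho> \<cdot> g \<cdot> w)"
proof -
  let ?k = "sem M \<Gamma> (kappa \<sigma>) \<rho> \<cdot> g \<cdot> w"
  define u where "u \<alpha> = g \<cdot> (pr1 M w \<cdot> \<alpha>)" for \<alpha>
  let ?V = "\<lambda>w. pr1 M w" and ?S = "\<lambda>w. pr1 M (pr2 M w)" and ?B = "\<lambda>w. pr2 M (pr2 M w)"
  have bn_u: "bar_nucleus M \<sigma> (u (hat M s))" for s
    using V_app_cases[OF w hat_Dom[of s]] bn_g unfolding u_def by metis
  \<comment> \<open>The element selected by \<open>w\<close> is frozen once \<open>w\<close> is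
    secured.\<close>
  have u_snoc: "u (hat M (s @ [n])) = u (hat M s)" if "holds M (?S w) s" for s n
    using bn_w that secures_snoc unfolding u_def bar_nucleus_def by metis
  \<comment> \<open>Two-valuedness lets both values be written as numerals at most 1, where the
    minimum acts as conjunction.\<close>
  have S: "?S ?k \<cdot> sq M s \<in> {num M 0, num M 1} \<and>
      (holds M (?S ?k) s \<longleftrightarrow> holds M (?S w) s \<and> holds M (?S (u (hat M s))) s)" for s
  proof -
    obtain a b where "a \<le> 1" "b \<le> 1" "?S w \<cdot> sq M s = num M a" "?S (u (hat M s)) \<cdot> sq M s = num M b"
      using bn_w bn_u[of s] unfolding bar_nucleus_def two_valued_def
      by (metis (no_types, lifting) insertE le_numeral_extra(3,4) less_eq_nat.simps(1) singletonD)
    then show ?thesis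
      using sem_kappa(2)[OF env g w, of s a b] by (auto simp: u_def holds_def min_def)
  qed
  have "two_valued M (?S ?k)" using S by (simp add: two_valued_def)
  \<comment> \<open>The second conjunct at \<open>s @ [n]\<close> refers to
    \<open>u (hat M (s @ [n]))\<close>; by \<open>u_snoc\<close> this is still
    \<open>u (hat M s)\<close>, whose own monotonicity applies.\<close>
  moreover have "monotone_pred M (?S ?k)"
    using S bn_w bn_u u_snoc unfolding monotone_pred_def bar_nucleus_def by metis
  moreover have "secures M (?S ?k) (?V ?k)"
    unfolding secures_def
  proof (intro allI impI ballI)
    fix s \<alpha> assume h: "holds M (?S ?k) s" and \<alpha>: "\<alpha> \<in> Dom M (N \<rightarrow> N)"
    \<comment> \<open>Two replacements are made: the first equation fixes the selected element, the
      second its value.\<close>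
    have "?V w \<cdot> conc M s \<alpha> = ?V w \<cdot> hat M s"
      "?V (u (hat M s)) \<cdot> conc M s \<alpha> = ?V (u (hat M s)) \<cdot> hat M s"
      using S h \<alpha> bn_w bn_u unfolding bar_nucleus_def secures_def by blast+
    then show "?V ?k \<cdot> conc M s \<alpha> = ?V ?k \<cdot> hat M s"
      using \<alpha> by (simp add: sem_kappa(1)[OF env g w] conc_app u_def)
  qed
  moreover have "GBR M \<sigma> (?S ?k) (?B ?k)"
    unfolding GBR_def
  proof (intro ballI allI)
    fix G H s assume G: "G \<in> Dom M (G_ty \<sigma>)" and H: "H \<in> Dom M (H_ty \<sigma>)"
    obtain G' where G': "G' \<in> Dom M (G_ty \<sigma>)"
      and G'_app: "\<And>s. G' \<cdot> sq M s = ?B (u (hat M s)) \<cdot> G \<cdot> H \<cdot> sq M s"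
      and B: "?B ?k \<cdot> G \<cdot> H = ?B w \<cdot> G' \<cdot> H"
      using sem_kappa(3)[OF env g w G H] unfolding u_def by blast
    \<comment> \<open>The recursion of \<open>w\<close> is used with leaves \<open>G'\<close>, at
      all sequences; \<open>bar_u\<close> below concerns the element selected at the current
      \<open>s\<close> only.\<close>
    have bar_w: "holds M (?S w) s \<Longrightarrow> ?B w \<cdot> G' \<cdot> H \<cdot> sq M s = G' \<cdot> sq M s"
      "\<not> holds M (?S w) s \<Longrightarrow> ?B w \<cdot> G' \<cdot> H \<cdot> sq M s =
         H \<cdot> sq M s \<cdot> lamN M \<sigma> (\<lambda>n. ?B w \<cdot> G' \<cdot> H \<cdot> sq M (s @ [n]))" for s
      using bn_w G' H unfolding bar_nucleus_def GBR_def by blast+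
    have bar_u: "holds M (?S (u (hat M s))) s \<Longrightarrow> ?B (u (hat M s)) \<cdot> G \<cdot> H \<cdot> sq M s = G \<cdot> sq M s"
      "\<not> holds M (?S (u (hat M s))) s \<Longrightarrow> ?B (u (hat M s)) \<cdot> G \<cdot> H \<cdot> sq M s =
         H \<cdot> sq M s \<cdot> lamN M \<sigma> (\<lambda>n. ?B (u (hat M s)) \<cdot> G \<cdot> H \<cdot> sq M (s @ [n]))"
      using bn_u[of s] G H unfolding bar_nucleus_def GBR_def by blast+
    show "(holds M (?S ?k) s \<longrightarrow> ?B ?k \<cdot> G \<cdot> H \<cdot> sq M s = G \<cdot> sq M s) \<and>
        (\<not> holds M (?S ?k) s \<longrightarrow> ?B ?k \<cdot> G \<cdot> H \<cdot> sq M s =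
           H \<cdot> sq M s \<cdot> lamN M \<sigma> (\<lambda>n. ?B ?k \<cdot> G \<cdot> H \<cdot> sq M (s @ [n])))"
    proof (cases "holds M (?S w) s")
      case True
      \<comment> \<open>All successors of \<open>s\<close> are also leaves for \<open>w\<close>, and
        they select the same element as \<open>s\<close>. Hence the equation to prove becomes the
        one for \<open>u (hat M s)\<close>.\<close>
      then have "holds M (?S w) (s @ [n])" for n
        using bn_w unfolding bar_nucleus_def monotone_pred_def by blast
      then have "?B w \<cdot> G' \<cdot> H \<cdot> sq M (s @ [n]) = ?B (u (hat M s)) \<cdot> G \<cdot> H \<cdot> sq M (s @ [n])" for n
        by (simp add: bar_w(1) G'_app u_snoc[OF True])
      then show ?thesis
        using bar_w(1)[OF True] bar_u S[of s] True by (simp add: B G'_app)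
    next
      case False
      \<comment> \<open>Here the predicate of \<open>?k\<close> fails too, and after rewriting with
        \<open>B\<close> the claim is the unfolding of the recursion of \<open>w\<close>.\<close>
      then show ?thesis using bar_w(2) S[of s] by (simp add: B)
    qed
  qed
  ultimately show ?thesis unfolding bar_nucleus_def by blast
qed

section \<open>Closure properties of the logical relation\<close>

lemma tracks_Dom:
  assumes "tracks M \<sigma> \<tau> f a"
  shows "\<alpha> \<in> Dom M (N \<rightarrow> N) \<Longrightarrow> f \<alpha> \<in> Dom M \<tau>" "a \<in> Dom M (J_ty (JN \<sigma>) \<tau>)"
proof -
  show "a \<in> Dom M (J_ty (JN \<sigma>) \<tau>)" using assms by (cases \<tau>) simp_all
  show "f \<alpha> \<in> Dom M \<tau>" if \<alpha>: "\<alpha> \<in> Dom M (N \<rightarrow> N)"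
  proof (cases \<tau>)
    case N
    then show ?thesis using assms \<alpha> app_Dom[OF JN_Dom(1) \<alpha>, of a \<sigma>] by simp
  qed (use assms \<alpha> in simp_all)
qed

lemma tracks_app:
  "tracks M \<sigma> (\<rho> \<rightarrow> \<tau>) f h \<Longrightarrow> tracks M \<sigma> \<rho> x a \<Longrightarrow>
    tracks M \<sigma> \<tau> (\<lambda>\<alpha>. f \<alpha> \<cdot> x \<alpha>) (h \<cdot> a)"
  by (simp only: tracks.simps(2))

text \<open>Evaluation equations are available only for \<open>\<alpha>\<close> in
  \<open>Dom M (N \<rightarrow> N)\<close>, so rewriting a family needs agreement there instead of
  equality of HOL functions.\<close>

lemma tracks_cong:
  assumes "tracks M \<sigma> \<tau> f a" "\<And>\<alpha>. \<alpha> \<in> Dom M (N \<rightarrow> N) \<Longrightarrow> f \<alpha> = f' \<alpha>"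
  shows "tracks M \<sigma> \<tau> f' a"
  using assms
proof (induction \<tau> arbitrary: f f' a)
  case N
  then show ?case by simp
next
  case (Fun \<rho> \<tau>)
  have "tracks M \<sigma> \<tau> (\<lambda>\<alpha>. f' \<alpha> \<cdot> x \<alpha>) (a \<cdot> b)" if "tracks M \<sigma> \<rho> x b" for x b
    using Fun.IH(2)[of "\<lambda>\<alpha>. f \<alpha> \<cdot> x \<alpha>"] Fun.prems that by simp
  then show ?case using Fun.prems by simp
next
  case (Prd \<rho> \<tau>)
  have "tracks M \<sigma> \<rho> (\<lambda>\<alpha>. pr1 M (f' \<alpha>)) (pr1 M a)"
    by (rule Prd.IH(1)[of "\<lambda>\<alpha>. pr1 M (f \<alpha>)"]) (use Prd.prems in simp_all)
  moreover have "tracks M \<sigma> \<tau> (\<lambda>\<alpha>. pr2 M (f' \<alpha>)) (pr2 M a)"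
    by (rule Prd.IH(2)[of "\<lambda>\<alpha>. pr2 M (f \<alpha>)"]) (use Prd.prems in simp_all)
  ultimately show ?case using Prd.prems by simp
qed

lemma tracks_eta: "env M \<Gamma> \<rho> \<Longrightarrow> tracks M \<sigma> N (\<lambda>\<alpha>. num M n) (sem M \<Gamma> (eta \<sigma>) \<rho> \<cdot> num M n)"
  by (simp add: eta_Dom bar_nucleus_eta sem_eta)

text \<open>\<open>F\<close> has two arguments because \<open>\<alpha>\<close> is used twice: once
  to compute the number that selects an element, once as the argument of that element.\<close>

lemma tracks_kappa:
  assumes "env M \<Gamma> \<rho>" "g \<in> Dom M (N \<rightarrow> JN \<sigma>)"
    and g: "\<And>n. tracks M \<sigma> N (F (num M n)) (g \<cdot> num M n)" and w: "tracks M \<sigma> N f w"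
  shows "tracks M \<sigma> N (\<lambda>\<alpha>. F (f \<alpha>) \<alpha>) (sem M \<Gamma> (kappa \<sigma>) \<rho> \<cdot> g \<cdot> w)"
proof -
  have "pr1 M (sem M \<Gamma> (kappa \<sigma>) \<rho> \<cdot> g \<cdot> w) \<cdot> \<alpha> = F (f \<alpha>) \<alpha>" if \<alpha>: "\<alpha> \<in> Dom M (N \<rightarrow> N)" for \<alpha>
  proof -
    obtain n where "f \<alpha> = num M n" using tracks_Dom(1)[OF w \<alpha>] by (rule Dom_N_cases)
    then show ?thesis using assms \<alpha> sem_kappa(1)[of \<Gamma> \<rho> g \<sigma> w \<alpha>] by simp
  qed
  then show ?thesis using assms by (simp add: kappa_Dom bar_nucleus_kappa)
qed

text \<open>Induction on the type reduces to \<open>kappa\<close> at \<open>N\<close>: arrows are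
  handled by supplying the extra argument first, products by projecting first. Context,
  \<open>g\<close> and \<open>F\<close> are generalized because the recursive call sits below
  binders and receives a modified \<open>g\<close>.\<close>

lemma tracks_ke:
  assumes "env M \<Gamma> \<rho>" "g \<in> Dom M (N \<rightarrow> J_ty (JN \<sigma>) \<tau>)"
    and "\<And>n. tracks M \<sigma> \<tau> (F (num M n)) (g \<cdot> num M n)" and "tracks M \<sigma> N f w"
  shows "tracks M \<sigma> \<tau> (\<lambda>\<alpha>. F (f \<alpha>) \<alpha>) (sem M \<Gamma> (ke (JN \<sigma>) (kappa \<sigma>) \<tau>) \<rho> \<cdot> g \<cdot> w)"
  using assms
proof (induction \<tau> arbitrary: \<Gamma> \<rho> g F)
  case N
  then show ?case using tracks_kappa[of \<Gamma> \<rho> g \<sigma> F f w] by (simp del: tracks.simps)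
next
  case (Fun \<rho>' \<tau>)
  let ?J = "J_ty (JN \<sigma>)"
  have w: "w \<in> Dom M (JN \<sigma>)" using tracks_Dom(2)[OF Fun.prems(4)] by simp
  have F: "F (f \<alpha>) \<alpha> \<in> Dom M (\<rho>' \<rightarrow> \<tau>)" if "\<alpha> \<in> Dom M (N \<rightarrow> N)" for \<alpha>
    using tracks_Dom(1)[OF Fun.prems(3) that] tracks_Dom(1)[OF Fun.prems(4) that]
    by (auto elim!: Dom_N_cases)
  have k: "sem M \<Gamma> (ke (JN \<sigma>) (kappa \<sigma>) (\<rho>' \<rightarrow> \<tau>)) \<rho> \<cdot> g \<cdot> w \<in> Dom M (?J (\<rho>' \<rightarrow> \<tau>))"
    using Fun.prems(1,2) w by (intro app_Dom[OF app_Dom] sem_Dom_tyof tyof_ke) auto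
  have "tracks M \<sigma> \<tau> (\<lambda>\<alpha>. F (f \<alpha>) \<alpha> \<cdot> x \<alpha>)
      (sem M \<Gamma> (ke (JN \<sigma>) (kappa \<sigma>) (\<rho>' \<rightarrow> \<tau>)) \<rho> \<cdot> g \<cdot> w \<cdot> a)" if xa: "tracks M \<sigma> \<rho>' x a" for x a
  proof -
    let ?\<Gamma> = "?J \<rho>' # JN \<sigma> # (N \<rightarrow> ?J (\<rho>' \<rightarrow> \<tau>)) # \<Gamma>" and ?\<rho> = "a # w # g # \<rho>"
    \<comment> \<open>This is \<open>g\<close> with the argument \<open>a\<close> inserted; the
      binder \<open>Lam N\<close> moves \<open>a\<close> to index 1 and \<open>g\<close> to index
      3.\<close>
    let ?h = "sem M ?\<Gamma> (Lam N (Var 3 \<bullet> Var 0 \<bullet> Var 1)) ?\<rho>"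
    have a: "a \<in> Dom M (?J \<rho>')" using tracks_Dom(2)[OF xa] .
    have env: "env M ?\<Gamma> ?\<rho>" using Fun.prems(1,2) a w by simp
    have h: "?h \<in> Dom M (N \<rightarrow> ?J \<tau>)" using env by (intro sem_Dom_tyof) simp_all
    have h_app: "?h \<cdot> num M n = g \<cdot> num M n \<cdot> a" for n
      using env by (simp add: sem_eval)
    have "tracks M \<sigma> \<tau> (\<lambda>\<alpha>. F (num M n) \<alpha> \<cdot> x \<alpha>) (?h \<cdot> num M n)" for n
      unfolding h_app by (rule tracks_app[OF Fun.prems(3) xa])
    \<comment> \<open>The argument family \<open>x\<close> is absorbed into the second argument of
      \<open>F\<close>.\<close>
    from Fun.IH(2)[OF env h, of "\<lambda>m \<alpha>. F m \<alpha> \<cdot> x \<alpha>", OF this Fun.prems(4)]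
    show ?thesis using env by (simp add: sem_eval)
  qed
  then show ?case using F k by simp
next
  case (Prd \<rho>' \<tau>)
  let ?J = "J_ty (JN \<sigma>)"
  have w: "w \<in> Dom M (JN \<sigma>)" using tracks_Dom(2)[OF Prd.prems(4)] by simp
  have F: "F (f \<alpha>) \<alpha> \<in> Dom M (\<rho>' \<otimes> \<tau>)" if "\<alpha> \<in> Dom M (N \<rightarrow> N)" for \<alpha>
    using tracks_Dom(1)[OF Prd.prems(3) that] tracks_Dom(1)[OF Prd.prems(4) that]
    by (auto elim!: Dom_N_cases)
  let ?k = "sem M \<Gamma> (ke (JN \<sigma>) (kappa \<sigma>) (\<rho>' \<otimes> \<tau>)) \<rho> \<cdot> g \<cdot> w"
  have k: "?k \<in> Dom M (?J (\<rho>' \<otimes> \<tau>))"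
    using Prd.prems(1,2) w by (intro app_Dom[OF app_Dom] sem_Dom_tyof tyof_ke) auto
  let ?\<Gamma> = "JN \<sigma> # (N \<rightarrow> ?J (\<rho>' \<otimes> \<tau>)) # \<Gamma>" and ?\<rho> = "w # g # \<rho>"
  let ?g1 = "sem M ?\<Gamma> (Lam N (Fst (Var 2 \<bullet> Var 0))) ?\<rho>"
  let ?g2 = "sem M ?\<Gamma> (Lam N (Snd (Var 2 \<bullet> Var 0))) ?\<rho>"
  have env: "env M ?\<Gamma> ?\<rho>" using Prd.prems(1,2) w by simp
  have g12: "?g1 \<in> Dom M (N \<rightarrow> ?J \<rho>')" "?g2 \<in> Dom M (N \<rightarrow> ?J \<tau>)"
    using env by (auto intro!: sem_Dom_tyof)
  have g12_app: "?g1 \<cdot> num M n = pr1 M (g \<cdot> num M n)" "?g2 \<cdot> num M n = pr2 M (g \<cdot> num M n)" for n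
    using env by (simp_all add: sem_eval)
  have "tracks M \<sigma> \<rho>' (\<lambda>\<alpha>. pr1 M (F (num M n) \<alpha>)) (?g1 \<cdot> num M n)"
    "tracks M \<sigma> \<tau> (\<lambda>\<alpha>. pr2 M (F (num M n) \<alpha>)) (?g2 \<cdot> num M n)" for n
    unfolding g12_app using Prd.prems(3)[of n] by simp_all
  then have "tracks M \<sigma> \<rho>' (\<lambda>\<alpha>. pr1 M (F (f \<alpha>) \<alpha>)) (sem M ?\<Gamma> (ke (JN \<sigma>) (kappa \<sigma>) \<rho>') ?\<rho> \<cdot> ?g1 \<cdot> w)"
    "tracks M \<sigma> \<tau> (\<lambda>\<alpha>. pr2 M (F (f \<alpha>) \<alpha>)) (sem M ?\<Gamma> (ke (JN \<sigma>) (kappa \<sigma>) \<tau>) ?\<rho> \<cdot> ?g2 \<cdot> w)"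
    using Prd.IH(1)[OF env g12(1), of "\<lambda>m \<alpha>. pr1 M (F m \<alpha>)"]
      Prd.IH(2)[OF env g12(2), of "\<lambda>m \<alpha>. pr2 M (F m \<alpha>)"] Prd.prems(4) by auto
  moreover have "pr1 M ?k = sem M ?\<Gamma> (ke (JN \<sigma>) (kappa \<sigma>) \<rho>') ?\<rho> \<cdot> ?g1 \<cdot> w"
    "pr2 M ?k = sem M ?\<Gamma> (ke (JN \<sigma>) (kappa \<sigma>) \<tau>) ?\<rho> \<cdot> ?g2 \<cdot> w"
    using env by (simp_all add: sem_eval)
  ultimately show ?case using F k by simp
qed

section \<open>The fundamental lemma\<close>

lemma tracks_env_Cons:
  "tracks_env M \<sigma> \<Gamma> fs ws \<Longrightarrow> tracks M \<sigma> \<tau> f w \<Longrightarrow> tracks_env M \<sigma> (\<tau> # \<Gamma>) (f # fs) (w # ws)"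
  by (auto simp: tracks_env_def nth_Cons split: nat.splits)

lemma tracks_env_imp_env:
  assumes "tracks_env M \<sigma> \<Gamma> fs ws"
  shows "\<alpha> \<in> Dom M (N \<rightarrow> N) \<Longrightarrow> env M \<Gamma> (map (\<lambda>f. f \<alpha>) fs)" "env M (map (J_ty (JN \<sigma>)) \<Gamma>) ws"
  using assms tracks_Dom unfolding tracks_env_def env_def list_all2_conv_all_nth
  by (auto simp: nth_map)

text \<open>Induction on typing. Each variable carries a family; at \<open>\<alpha>\<close> the
  source term is evaluated with these families at \<open>\<alpha>\<close>, while the translated term
  uses the fixed values \<open>ws\<close>. The real work is in \<open>Succ\<close> and
  \<open>Rec\<close>, where a tracked number must be reduced to numerals.\<close>

lemma tracks_J_trm:
  assumes "\<Gamma> \<turnstile> t \<Colon> \<tau>" "tracks_env M \<sigma> \<Gamma> fs ws"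
  shows "tracks M \<sigma> \<tau> (\<lambda>\<alpha>. sem M \<Gamma> t (map (\<lambda>f. f \<alpha>) fs))
    (sem M (map (J_ty (JN \<sigma>)) \<Gamma>) (J_trm (JN \<sigma>) (eta \<sigma>) (kappa \<sigma>) t) ws)"
  using assms
proof (induction arbitrary: fs ws rule: typing.induct)
  case (1 i \<Gamma>)
  note e = tracks_env_imp_env[OF 1(2)]
  have "tracks M \<sigma> (\<Gamma> ! i) (fs ! i) (ws ! i)" and len: "length fs = length \<Gamma>"
    using 1 by (auto simp: tracks_env_def)
  then show ?case
    using 1(1) e by (auto simp: sem_Var intro: tracks_cong)
next
  case (2 \<rho> \<Gamma> t \<tau>)
  note e = tracks_env_imp_env[OF 2(3)]
  let ?J = "J_ty (JN \<sigma>)" and ?t = "J_trm (JN \<sigma>) (eta \<sigma>) (kappa \<sigma>) t"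
  have ty: "map ?J \<Gamma> \<turnstile> Lam (?J \<rho>) ?t \<Colon> ?J \<rho> \<rightarrow> ?J \<tau>" "?J \<rho> # map ?J \<Gamma> \<turnstile> ?t \<Colon> ?J \<tau>"
    using tyof_J_trm[OF _ _ 2(1), of "kappa \<sigma>" "JN \<sigma>" "eta \<sigma>"] by (auto simp: typing_iff)
  have "tracks M \<sigma> \<tau> (\<lambda>\<alpha>. sem M \<Gamma> (Lam \<rho> t) (map (\<lambda>f. f \<alpha>) fs) \<cdot> x \<alpha>)
      (sem M (map ?J \<Gamma>) (Lam (?J \<rho>) ?t) ws \<cdot> a)" if xa: "tracks M \<sigma> \<rho> x a" for x a
  proof -
    note d = tracks_Dom[OF xa]
    have "tracks M \<sigma> \<tau> (\<lambda>\<alpha>. sem M (\<rho> # \<Gamma>) t (x \<alpha> # map (\<lambda>f. f \<alpha>) fs))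
        (sem M (?J \<rho> # map ?J \<Gamma>) ?t (a # ws))"
      using 2(2)[OF tracks_env_Cons[OF 2(3) xa]] by simp
    then show ?thesis
      unfolding sem_Lam[OF ty(2) e(2) d(2)]
      by (rule tracks_cong) (simp add: sem_Lam[OF 2(1) e(1) d(1)])
  qed
  moreover have "sem M \<Gamma> (Lam \<rho> t) (map (\<lambda>f. f \<alpha>) fs) \<in> Dom M (\<rho> \<rightarrow> \<tau>)"
    if "\<alpha> \<in> Dom M (N \<rightarrow> N)" for \<alpha>
    using sem_Dom[OF typing.intros(2)[OF 2(1)] e(1)[OF that]] .
  ultimately show ?case using sem_Dom[OF ty(1) e(2)] by simp
next
  case (3 \<Gamma> t \<rho> \<tau> u)
  note e = tracks_env_imp_env[OF 3(5)]
  let ?J = "J_ty (JN \<sigma>)" and ?T = "J_trm (JN \<sigma>) (eta \<sigma>) (kappa \<sigma>)"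
  have ty: "map ?J \<Gamma> \<turnstile> ?T t \<Colon> ?J \<rho> \<rightarrow> ?J \<tau>" "map ?J \<Gamma> \<turnstile> ?T u \<Colon> ?J \<rho>"
    using tyof_J_trm[OF _ _ 3(1), of "kappa \<sigma>" "JN \<sigma>" "eta \<sigma>"]
      tyof_J_trm[OF _ _ 3(2), of "kappa \<sigma>" "JN \<sigma>" "eta \<sigma>"] by (auto simp: typing_iff)
  have "tracks M \<sigma> \<tau> (\<lambda>\<alpha>. sem M \<Gamma> t (map (\<lambda>f. f \<alpha>) fs) \<cdot> sem M \<Gamma> u (map (\<lambda>f. f \<alpha>) fs))
      (sem M (map ?J \<Gamma>) (?T t) ws \<cdot> sem M (map ?J \<Gamma>) (?T u) ws)"
    by (rule tracks_app[OF 3(3)[OF 3(5)] 3(4)[OF 3(5)]])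
  then have "tracks M \<sigma> \<tau> (\<lambda>\<alpha>. sem M \<Gamma> (t \<bullet> u) (map (\<lambda>f. f \<alpha>) fs))
      (sem M (map ?J \<Gamma>) (?T t) ws \<cdot> sem M (map ?J \<Gamma>) (?T u) ws)"
    by (rule tracks_cong) (simp add: sem_App[OF 3(1,2) e(1)])
  then show ?case by (simp add: sem_App[OF ty e(2)])
next
  case (4 \<Gamma>)
  note e = tracks_env_imp_env[OF 4]
  have "tracks M \<sigma> N (\<lambda>\<alpha>. sem M \<Gamma> Zero (map (\<lambda>f. f \<alpha>) fs))
      (sem M (map (J_ty (JN \<sigma>)) \<Gamma>) (eta \<sigma>) ws \<cdot> num M 0)"
    by (rule tracks_cong[OF tracks_eta[OF e(2)]]) (simp add: sem_Zero[OF e(1)])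
  then show ?case using e(2) by (simp add: sem_eval del: tracks.simps)
next
  case (5 \<Gamma>)
  note e = tracks_env_imp_env[OF 5]
  let ?\<Gamma> = "map (J_ty (JN \<sigma>)) \<Gamma>"
  let ?k = "sem M ?\<Gamma> (kappa \<sigma> \<bullet> Lam N (eta \<sigma> \<bullet> (Succ \<bullet> Var 0))) ws"
  have "tracks M \<sigma> N (\<lambda>\<alpha>. sem M \<Gamma> Succ (map (\<lambda>f. f \<alpha>) fs) \<cdot> x \<alpha>) (?k \<cdot> a)"
    if xa: "tracks M \<sigma> N x a" for x a
  proof -
    let ?g = "sem M ?\<Gamma> (Lam N (eta \<sigma> \<bullet> (Succ \<bullet> Var 0))) ws"
    have g: "?g \<in> Dom M (N \<rightarrow> JN \<sigma>)" using e(2) by (intro sem_Dom_tyof) simp_all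
    have "tracks M \<sigma> N (\<lambda>\<alpha>. sem M \<Gamma> Succ (map (\<lambda>f. f \<alpha>) fs) \<cdot> num M n) (?g \<cdot> num M n)" for n
    proof -
      have "?g \<cdot> num M n = sem M (N # ?\<Gamma>) (eta \<sigma>) (num M n # ws) \<cdot> num M (Suc n)"
        using e(2) by (simp add: sem_eval)
      moreover have "tracks M \<sigma> N (\<lambda>\<alpha>. sem M \<Gamma> Succ (map (\<lambda>f. f \<alpha>) fs) \<cdot> num M n)
          (sem M (N # ?\<Gamma>) (eta \<sigma>) (num M n # ws) \<cdot> num M (Suc n))"
        by (rule tracks_cong[OF tracks_eta]) (use e in \<open>simp_all add: sem_Succ\<close>)
      ultimately show ?thesis by simp
    qed
    then have "tracks M \<sigma> N (\<lambda>\<alpha>. sem M \<Gamma> Succ (map (\<lambda>f. f \<alpha>) fs) \<cdot> x \<alpha>)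
        (sem M ?\<Gamma> (kappa \<sigma>) ws \<cdot> ?g \<cdot> a)"
      \<comment> \<open>The family \<open>F\<close> ignores \<open>\<alpha>\<close> up to the
        environment and applies the successor to its number.\<close>
      using tracks_kappa[OF e(2) g, of "\<lambda>m \<alpha>. sem M \<Gamma> Succ (map (\<lambda>f. f \<alpha>) fs) \<cdot> m", OF _ xa]
      by blast
    moreover have "?k = sem M ?\<Gamma> (kappa \<sigma>) ws \<cdot> ?g" using e(2) by (simp add: sem_eval)
    ultimately show ?thesis by simp
  qed
  moreover have "?k \<in> Dom M (JN \<sigma> \<rightarrow> JN \<sigma>)" using e(2) by (intro sem_Dom_tyof) simp_all
  moreover have "sem M \<Gamma> Succ (map (\<lambda>f. f \<alpha>) fs) \<in> Dom M (N \<rightarrow> N)"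
    if "\<alpha> \<in> Dom M (N \<rightarrow> N)" for \<alpha>
    using e(1)[OF that] by (intro sem_Dom_tyof) simp_all
  ultimately show ?case by (simp del: tracks.simps(1))
next
  case (6 \<Gamma> \<tau>)
  note e = tracks_env_imp_env[OF 6]
  let ?J = "J_ty (JN \<sigma>)" and ?R = "\<lambda>\<alpha>. sem M \<Gamma> (Rec \<tau>) (map (\<lambda>f. f \<alpha>) fs)"
  let ?r = "sem M (map ?J \<Gamma>) (J_trm (JN \<sigma>) (eta \<sigma>) (kappa \<sigma>) (Rec \<tau>)) ws"
  have R: "?R \<alpha> \<in> Dom M (\<tau> \<rightarrow> (N \<rightarrow> \<tau> \<rightarrow> \<tau>) \<rightarrow> N \<rightarrow> \<tau>)" if "\<alpha> \<in> Dom M (N \<rightarrow> N)" for \<alpha>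
    using e(1)[OF that] by (intro sem_Dom_tyof) simp_all
  have r: "?r \<in> Dom M (?J (\<tau> \<rightarrow> (N \<rightarrow> \<tau> \<rightarrow> \<tau>) \<rightarrow> N \<rightarrow> \<tau>))"
    using e(2) by (intro sem_Dom_tyof) simp_all
  \<comment> \<open>The recursor is treated with all three arguments present; the arrows are put
    back afterwards, one at a time.\<close>
  have main: "tracks M \<sigma> \<tau> (\<lambda>\<alpha>. ?R \<alpha> \<cdot> x \<alpha> \<cdot> f \<alpha> \<cdot> m \<alpha>) (?r \<cdot> a \<cdot> b \<cdot> w)"
    if xa: "tracks M \<sigma> \<tau> x a" and fb: "tracks M \<sigma> (N \<rightarrow> \<tau> \<rightarrow> \<tau>) f b" and mw: "tracks M \<sigma> N m w"
    for x a f b m w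
  proof -
    note da = tracks_Dom[OF xa] and db = tracks_Dom[OF fb]
    let ?\<Gamma> = "(JN \<sigma> \<rightarrow> ?J \<tau> \<rightarrow> ?J \<tau>) # ?J \<tau> # map ?J \<Gamma>" and ?\<rho> = "b # a # ws"
    let ?b = "Lam N (Var 1 \<bullet> (eta \<sigma> \<bullet> Var 0))"
    \<comment> \<open>The recursion inside the translated recursor still runs over actual numbers,
      so induction applies to it.\<close>
    let ?g = "sem M ?\<Gamma> (Rec (?J \<tau>)) ?\<rho> \<cdot> a \<cdot> sem M ?\<Gamma> ?b ?\<rho>"
    have env: "env M ?\<Gamma> ?\<rho>" using e(2) da(2) db(2) by simp
    have g: "?g \<in> Dom M (N \<rightarrow> ?J \<tau>)"
      using env da(2) by (intro app_Dom[OF app_Dom] sem_Dom_tyof) auto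
    have "tracks M \<sigma> \<tau> (\<lambda>\<alpha>. ?R \<alpha> \<cdot> x \<alpha> \<cdot> f \<alpha> \<cdot> num M n) (?g \<cdot> num M n)" for n
    proof (induction n)
      case 0
      have "tracks M \<sigma> \<tau> (\<lambda>\<alpha>. ?R \<alpha> \<cdot> x \<alpha> \<cdot> f \<alpha> \<cdot> num M 0) a"
        by (rule tracks_cong[OF xa]) (simp add: sem_Rec_0[OF e(1) da(1) db(1)])
      then show ?case using env da(2) by (simp add: sem_eval_Rec_0)
    next
      case (Suc n)
      \<comment> \<open>The step function \<open>b\<close> expects a translated number;
        \<open>eta\<close> supplies one that tracks the constant family \<open>n\<close>.\<close>
      let ?en = "sem M (N # ?\<Gamma>) (eta \<sigma>) (num M n # ?\<rho>) \<cdot> num M n"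
      have "tracks M \<sigma> N (\<lambda>\<alpha>. num M n) ?en" using env by (intro tracks_eta) simp
      then have "tracks M \<sigma> (\<tau> \<rightarrow> \<tau>) (\<lambda>\<alpha>. f \<alpha> \<cdot> num M n) (b \<cdot> ?en)"
        by (rule tracks_app[OF fb])
      then have "tracks M \<sigma> \<tau> (\<lambda>\<alpha>. f \<alpha> \<cdot> num M n \<cdot> (?R \<alpha> \<cdot> x \<alpha> \<cdot> f \<alpha> \<cdot> num M n))
          (b \<cdot> ?en \<cdot> (?g \<cdot> num M n))"
        using Suc by (rule tracks_app)
      then have "tracks M \<sigma> \<tau> (\<lambda>\<alpha>. ?R \<alpha> \<cdot> x \<alpha> \<cdot> f \<alpha> \<cdot> num M (Suc n)) (b \<cdot> ?en \<cdot> (?g \<cdot> num M n))"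
        by (rule tracks_cong) (simp add: sem_Rec_Suc[OF e(1) da(1) db(1)])
      moreover have "sem M ?\<Gamma> ?b ?\<rho> \<cdot> num M n = b \<cdot> ?en" using env by (simp add: sem_eval)
      ultimately show ?case using env da(2) by (simp add: sem_eval_Rec_Suc)
    qed
    \<comment> \<open>The extension passes from numerals to the tracked number \<open>m\<close>,
      whose value may vary with \<open>\<alpha>\<close>.\<close>
    from tracks_ke[OF env g, of "\<lambda>m \<alpha>. ?R \<alpha> \<cdot> x \<alpha> \<cdot> f \<alpha> \<cdot> m", OF this mw]
    show ?thesis using env by (simp add: sem_eval)
  qed
  have "tracks M \<sigma> ((N \<rightarrow> \<tau> \<rightarrow> \<tau>) \<rightarrow> N \<rightarrow> \<tau>) (\<lambda>\<alpha>. ?R \<alpha> \<cdot> x \<alpha>) (?r \<cdot> a)"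
    if xa: "tracks M \<sigma> \<tau> x a" for x a
  proof -
    note da = tracks_Dom[OF xa]
    have "tracks M \<sigma> (N \<rightarrow> \<tau>) (\<lambda>\<alpha>. ?R \<alpha> \<cdot> x \<alpha> \<cdot> f \<alpha>) (?r \<cdot> a \<cdot> b)"
      if fb: "tracks M \<sigma> (N \<rightarrow> \<tau> \<rightarrow> \<tau>) f b" for f b
    proof -
      note db = tracks_Dom[OF fb]
      have "?R \<alpha> \<cdot> x \<alpha> \<cdot> f \<alpha> \<in> Dom M (N \<rightarrow> \<tau>)" if "\<alpha> \<in> Dom M (N \<rightarrow> N)" for \<alpha>
        using app_Dom[OF app_Dom[OF R[OF that] da(1)[OF that]] db(1)[OF that]] .
      moreover have "?r \<cdot> a \<cdot> b \<in> Dom M (?J (N \<rightarrow> \<tau>))"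
        using app_Dom[OF app_Dom[OF r[simplified] da(2)] db(2)[simplified]] by simp
      ultimately show ?thesis
        unfolding tracks.simps(2) using main[OF xa fb] by blast
    qed
    moreover have "?R \<alpha> \<cdot> x \<alpha> \<in> Dom M ((N \<rightarrow> \<tau> \<rightarrow> \<tau>) \<rightarrow> N \<rightarrow> \<tau>)" if "\<alpha> \<in> Dom M (N \<rightarrow> N)" for \<alpha>
      using app_Dom[OF R[OF that] da(1)[OF that]] .
    moreover have "?r \<cdot> a \<in> Dom M (?J ((N \<rightarrow> \<tau> \<rightarrow> \<tau>) \<rightarrow> N \<rightarrow> \<tau>))"
      using app_Dom[OF r[simplified] da(2)] by simp
    ultimately show ?thesis
      unfolding tracks.simps(2)[of _ _ "N \<rightarrow> \<tau> \<rightarrow> \<tau>"] by blast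
  qed
  then show ?case using R r unfolding tracks.simps(2)[of _ _ \<tau> "(N \<rightarrow> \<tau> \<rightarrow> \<tau>) \<rightarrow> N \<rightarrow> \<tau>"] by blast
next
  case (7 \<Gamma> t \<rho> u \<tau>)
  note e = tracks_env_imp_env[OF 7(5)]
  let ?J = "J_ty (JN \<sigma>)" and ?T = "J_trm (JN \<sigma>) (eta \<sigma>) (kappa \<sigma>)"
  have ty: "map ?J \<Gamma> \<turnstile> ?T t \<Colon> ?J \<rho>" "map ?J \<Gamma> \<turnstile> ?T u \<Colon> ?J \<tau>"
    using tyof_J_trm[OF _ _ 7(1), of "kappa \<sigma>" "JN \<sigma>" "eta \<sigma>"]
      tyof_J_trm[OF _ _ 7(2), of "kappa \<sigma>" "JN \<sigma>" "eta \<sigma>"] by (auto simp: typing_iff)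
  have "tracks M \<sigma> \<rho> (\<lambda>\<alpha>. pr1 M (sem M \<Gamma> (Pr t u) (map (\<lambda>f. f \<alpha>) fs)))
      (sem M (map ?J \<Gamma>) (?T t) ws)"
    by (rule tracks_cong[OF 7(3)[OF 7(5)]]) (simp add: sem_Pr1[OF 7(1,2) e(1)])
  moreover have "tracks M \<sigma> \<tau> (\<lambda>\<alpha>. pr2 M (sem M \<Gamma> (Pr t u) (map (\<lambda>f. f \<alpha>) fs)))
      (sem M (map ?J \<Gamma>) (?T u) ws)"
    by (rule tracks_cong[OF 7(4)[OF 7(5)]]) (simp add: sem_Pr2[OF 7(1,2) e(1)])
  moreover have "sem M \<Gamma> (Pr t u) (map (\<lambda>f. f \<alpha>) fs) \<in> Dom M (\<rho> \<otimes> \<tau>)"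
    if "\<alpha> \<in> Dom M (N \<rightarrow> N)" for \<alpha>
    using sem_Dom[OF typing.intros(7)[OF 7(1,2)] e(1)[OF that]] .
  ultimately show ?case
    using sem_Dom[OF typing.intros(7)[OF ty] e(2)] sem_Pr1[OF ty e(2)] sem_Pr2[OF ty e(2)] by simp
next
  case (8 \<Gamma> t \<rho> \<tau>)
  note e = tracks_env_imp_env[OF 8(3)]
  have ty: "map (J_ty (JN \<sigma>)) \<Gamma> \<turnstile> J_trm (JN \<sigma>) (eta \<sigma>) (kappa \<sigma>) t \<Colon> J_ty (JN \<sigma>) \<rho> \<otimes> J_ty (JN \<sigma>) \<tau>"
    using tyof_J_trm[OF _ _ 8(1), of "kappa \<sigma>" "JN \<sigma>" "eta \<sigma>"] by (auto simp: typing_iff)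
  have "tracks M \<sigma> \<rho> (\<lambda>\<alpha>. pr1 M (sem M \<Gamma> t (map (\<lambda>f. f \<alpha>) fs)))
      (sem M (map (J_ty (JN \<sigma>)) \<Gamma>) (J_trm (JN \<sigma>) (eta \<sigma>) (kappa \<sigma>) (Fst t)) ws)"
    using 8(2)[OF 8(3)] by (simp add: sem_Fst[OF ty e(2)])
  then show ?case by (rule tracks_cong) (simp add: sem_Fst[OF 8(1) e(1)])
next
  case (9 \<Gamma> t \<rho> \<tau>)
  note e = tracks_env_imp_env[OF 9(3)]
  have ty: "map (J_ty (JN \<sigma>)) \<Gamma> \<turnstile> J_trm (JN \<sigma>) (eta \<sigma>) (kappa \<sigma>) t \<Colon> J_ty (JN \<sigma>) \<rho> \<otimes> J_ty (JN \<sigma>) \<tau>"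
    using tyof_J_trm[OF _ _ 9(1), of "kappa \<sigma>" "JN \<sigma>" "eta \<sigma>"] by (auto simp: typing_iff)
  have "tracks M \<sigma> \<tau> (\<lambda>\<alpha>. pr2 M (sem M \<Gamma> t (map (\<lambda>f. f \<alpha>) fs)))
      (sem M (map (J_ty (JN \<sigma>)) \<Gamma>) (J_trm (JN \<sigma>) (eta \<sigma>) (kappa \<sigma>) (Snd t)) ws)"
    using 9(2)[OF 9(3)] by (simp add: sem_Snd[OF ty e(2)])
  then show ?case by (rule tracks_cong) (simp add: sem_Snd[OF 9(1) e(1)])
qed

section \<open>The generic element and the conclusion\<close>

text \<open>Evaluation at \<open>n\<close> reads one position, so it is secured as soon as that
  position lies inside \<open>s\<close>; \<open>\<Psi>\<close> is bar recursion for exactly this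
  condition. Passing through \<open>kappa\<close> replaces the numeral \<open>n\<close> by a tracked
  number.\<close>

lemma tracks_Omega:
  assumes \<Psi>: "closed_term \<Psi> (N \<rightarrow> BR_ty \<sigma>)" "Psi_spec M \<sigma> (val M \<Psi>)"
  shows "tracks M \<sigma> (N \<rightarrow> N) (\<lambda>\<alpha>. \<alpha>) (val M (Omega \<sigma> \<Psi>))"
proof -
  let ?t = "Lam N
     (Pr (Lam (N \<rightarrow> N) (Var 0 \<bullet> Var 1))
     (Pr (Lam Sq (Le_t \<bullet> Var 1 \<bullet> (len_t \<bullet> Var 0)))
         (\<Psi> \<bullet> Var 0)))"
  note ty = tyof_closed[OF \<Psi>(1)]
  have g: "val M ?t \<in> Dom M (N \<rightarrow> JN \<sigma>)" by (intro sem_Dom_tyof) (simp_all add: ty JN_def)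
  have "tracks M \<sigma> N (\<lambda>\<alpha>. \<alpha> \<cdot> num M n) (val M ?t \<cdot> num M n)" for n
  proof -
    define w where "w = val M ?t \<cdot> num M n"
    have V: "pr1 M w \<cdot> \<alpha> = \<alpha> \<cdot> num M n" if "\<alpha> \<in> Dom M (N \<rightarrow> N)" for \<alpha>
      using that by (simp add: w_def sem_eval ty)
    have S: "pr1 M (pr2 M w) \<cdot> sq M s = num M (if n < length s then 1 else 0)" for s
      by (simp add: w_def sem_eval ty sem_Le_t sem_len_t)
    have B: "pr2 M (pr2 M w) = val M \<Psi> \<cdot> num M n"
      by (simp add: w_def sem_eval ty sem_closed[OF \<Psi>(1), of "[N]"])
    \<comment> \<open>Both case distinctions of \<open>Psi_spec\<close> now match those of
      \<open>GBR\<close>.\<close>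
    have holds: "holds M (pr1 M (pr2 M w)) s \<longleftrightarrow> n < length s" for s
      unfolding holds_def S by simp
    have "bar_nucleus M \<sigma> w"
      unfolding bar_nucleus_def two_valued_def monotone_pred_def secures_def GBR_def holds B S
      using \<Psi>(2) by (auto simp: V conc_app hat_app Psi_spec_def not_less)
    moreover have "w \<in> Dom M (JN \<sigma>)" unfolding w_def by (rule app_Dom[OF g num_Dom])
    ultimately show ?thesis unfolding w_def[symmetric] using V by simp
  qed
  then have "tracks M \<sigma> N (\<lambda>\<alpha>. \<alpha> \<cdot> f \<alpha>) (val M (kappa \<sigma>) \<cdot> val M ?t \<cdot> w)"
    if "tracks M \<sigma> N f w" for f w
    using tracks_kappa[OF env_Nil g, of "\<lambda>m \<alpha>. \<alpha> \<cdot> m", OF _ that] by blast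
  moreover have "val M (Omega \<sigma> \<Psi>) = val M (kappa \<sigma>) \<cdot> val M ?t"
    unfolding Omega_def
    by (rule sem_eval_App[where \<tau> = "JN \<sigma> \<rightarrow> JN \<sigma>"]) (simp_all add: ty JN_def)
  moreover have "val M (Omega \<sigma> \<Psi>) \<in> Dom M (JN \<sigma> \<rightarrow> JN \<sigma>)"
    by (intro sem_Dom_tyof) (simp_all add: Omega_def ty JN_def)
  ultimately show ?thesis by (simp del: tracks.simps(1))
qed

lemma tracks_YJ_Omega:
  assumes \<Psi>: "closed_term \<Psi> (N \<rightarrow> BR_ty \<sigma>)" "Psi_spec M \<sigma> (val M \<Psi>)"
    and Y: "closed_term Y ((N \<rightarrow> N) \<rightarrow> N)"
  shows "tracks M \<sigma> N (\<lambda>\<alpha>. val M Y \<cdot> \<alpha>) (val M (YJ_Omega \<sigma> \<Psi> Y))"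
proof -
  have "tracks_env M \<sigma> [] [] []" by (simp add: tracks_env_def)
  from tracks_app[OF tracks_J_trm[OF Y this] tracks_Omega[OF \<Psi>]]
  have "tracks M \<sigma> N (\<lambda>\<alpha>. val M Y \<cdot> \<alpha>)
      (val M (J_trm (JN \<sigma>) (eta \<sigma>) (kappa \<sigma>) Y) \<cdot> val M (Omega \<sigma> \<Psi>))"
    by (simp del: tracks.simps)
  moreover have "tyof [] (YJ_Omega \<sigma> \<Psi> Y) = Some (JN \<sigma>)"
    using closed_YJ_Omega[OF \<Psi>(1) Y] by (simp add: typing_iff)
  ultimately show ?thesis
    using sem_eval_App[OF _ env_Nil] unfolding YJ_Omega_def by simp
qed

end

theorem theorem11:
  fixes M :: "'u tstruct" and \<sigma> :: ty and \<Psi> Y :: trm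
  assumes "T_model M"
    and "closed_term \<Psi> (N \<rightarrow> BR_ty \<sigma>)"
    and "Psi_spec M \<sigma> (val M \<Psi>)"
    and "closed_term Y ((N \<rightarrow> N) \<rightarrow> N)"
  shows "(two_valued M (val M (S_c (YJ_Omega \<sigma> \<Psi> Y))) \<and>
          monotone_pred M (val M (S_c (YJ_Omega \<sigma> \<Psi> Y))) \<and>
          secures M (val M (S_c (YJ_Omega \<sigma> \<Psi> Y))) (val M Y)) \<and>
         GBR M \<sigma> (val M (S_c (YJ_Omega \<sigma> \<Psi> Y))) (val M (B_c (YJ_Omega \<sigma> \<Psi> Y)))"
proof -
  interpret T_model M by fact
  let ?w = "val M (YJ_Omega \<sigma> \<Psi> Y)"
  have ty: "tyof [] (YJ_Omega \<sigma> \<Psi> Y) = Some (JN \<sigma>)"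
    using closed_YJ_Omega[OF assms(2,4)] by (simp add: typing_iff)
  have "val M (S_c (YJ_Omega \<sigma> \<Psi> Y)) = pr1 M (pr2 M ?w)"
    "val M (B_c (YJ_Omega \<sigma> \<Psi> Y)) = pr2 M (pr2 M ?w)"
    using ty by (simp_all add: sem_eval JN_def)
  moreover have "bar_nucleus M \<sigma> ?w"
    and "\<And>\<alpha>. \<alpha> \<in> Dom M (N \<rightarrow> N) \<Longrightarrow> pr1 M ?w \<cdot>\<^bsub>M\<^esub> \<alpha> = val M Y \<cdot>\<^bsub>M\<^esub> \<alpha>"
    using tracks_YJ_Omega[OF assms(2-4)] by simp_all
  \<comment> \<open>The relation gives securing for the first component of \<open>?w\<close>. It
    passes to \<open>Y\<close> because the two functionals agree on
    \<open>Dom M (N \<rightarrow> N)\<close>, which contains both the concatenations and the zero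
    extensions.\<close>
  ultimately show ?thesis
    by (simp add: bar_nucleus_def secures_def conc_app)
qed

end
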